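(* Let $\mathcal{X}$ be a projective, nonsingular, geometrically irreducible curve of genus $g$ over $\mathbb{F}_q$. Let $\mathcal{P}$ be a proper subset of $\mathcal{X}(\mathbb{F}_q)$ and $D=\sum_{P\in\mathcal{P}}P$. Let $G,H,J$ be divisors on $\mathcal{X}$ of degree at most $\deg(D)-1$ such that $(\mathrm{supp}(G)\cup\mathrm{supp}(H)\cup\mathrm{supp}(J))\cap\mathrm{supp}(D)=\varnothing$. For each nonzero $f\in\mathscr{L}(J)$ let $H_f=H-(f)$. Then for every nonzero $f\in\mathscr{L}(J)$, \[ \ell\big(\gcd(G,H_f)\big)\le\dim\Big(C(D,G)\cap\big(\mathrm{ev}_D(f)*C(D,H)\big)\Big)\le\ell\big(\gcd(G,H_f)\big)+\ell\big(\mathrm{lcm}(G,H_f)-D\big). \]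
   Context: Divisors are formal $\mathbb{Z}$-combinations of points of $\mathcal{X}$ (here $\mathbb{F}_q$-rational); $(f)$ is the principal divisor of a nonzero function $f$; for $D_1=\sum n_PP$, $D_2=\sum m_PP$, $\gcd(D_1,D_2)=\sum\min(n_P,m_P)P$ and $\mathrm{lcm}(D_1,D_2)=\sum\max(n_P,m_P)P$. $\mathscr{L}(E)=\{f\in\mathbb{F}_q(\mathcal{X})^*:(f)+E\ge0\}\cup\{0\}$ and $\ell(E)=\dim\mathscr{L}(E)$. Writing $D=P_1+\dots+P_n$, $\mathrm{ev}_D(f)=(f(P_1),\dots,f(P_n))$ and, for a divisor $E$ whose support is disjoint from $\mathrm{supp}(D)$, $C(D,E)=\{\mathrm{ev}_D(f):f\in\mathscr{L}(E)\}\subseteq\mathbb{F}_q^n$. $*$ is the componentwise product of vectors and $v*C'=\{v*c:c\in C'\}$. *)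

theory Defs
  imports Complex_Main "HOL-Computational_Algebra.Polynomial" "HOL-Library.Function_Algebras"
begin

text \<open>
Model: the curve X over F_q is given through its function field F = F_q(X).
The finite field F_q is the type 'k, the function field is the type 'f,
and emb :: 'k => 'f is the embedding of the constant field.
Points of X (places of F) are identified with their normalized discrete
valuations v :: 'f => int (with the convention v 0 = 0).
\<close>

definition field_hom :: "('k::field \<Rightarrow> 'f::field) \<Rightarrow> bool" where
  "field_hom emb \<longleftrightarrow> emb 1 = 1 \<and> (\<forall>a b. emb (a + b) = emb a + emb b) \<and>
     (\<forall>a b. emb (a * b) = emb a * emb b)"

definition transc :: "('k::field \<Rightarrow> 'f::field) \<Rightarrow> 'f \<Rightarrow> bool" where
  "transc emb x \<longleftrightarrow> (\<forall>p::'k poly. p \<noteq> 0 \<longrightarrow> poly (map_poly emb p) x \<noteq> 0)"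

definition rat_fun_field :: "('k::field \<Rightarrow> 'f::field) \<Rightarrow> 'f \<Rightarrow> 'f set" where
  "rat_fun_field emb x = {poly (map_poly emb p) x / poly (map_poly emb r) x | p r. r \<noteq> 0}"

text \<open>F/k is an algebraic function field of one variable with full constant field k
  (= function field of a projective, nonsingular, geometrically irreducible curve over k)\<close>
definition function_field :: "('k::field \<Rightarrow> 'f::field) \<Rightarrow> bool" where
  "function_field emb \<longleftrightarrow> field_hom emb \<and>
     (\<exists>x. transc emb x \<and>
        (\<exists>B. finite B \<and> (\<forall>y. \<exists>c. (\<forall>b\<in>B. c b \<in> rat_fun_field emb x) \<and> y = (\<Sum>b\<in>B. c b * b)))) \<and>
     (\<forall>y. (\<exists>p::'k poly. p \<noteq> 0 \<and> poly (map_poly emb p) y = 0) \<longrightarrow> y \<in> range emb)"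

definition place :: "('k::field \<Rightarrow> 'f::field) \<Rightarrow> ('f \<Rightarrow> int) \<Rightarrow> bool" where
  "place emb v \<longleftrightarrow> v 0 = 0 \<and>
     (\<forall>x y. x \<noteq> 0 \<longrightarrow> y \<noteq> 0 \<longrightarrow> v (x * y) = v x + v y) \<and>
     (\<forall>x y. x \<noteq> 0 \<longrightarrow> y \<noteq> 0 \<longrightarrow> x + y \<noteq> 0 \<longrightarrow> v (x + y) \<ge> min (v x) (v y)) \<and>
     (\<forall>c. c \<noteq> 0 \<longrightarrow> v (emb c) = 0) \<and>
     (\<exists>t. v t = 1)"

text \<open>rational place (F_q-rational point): residue field equals k\<close>
definition rational_place :: "('k::field \<Rightarrow> 'f::field) \<Rightarrow> ('f \<Rightarrow> int) \<Rightarrow> bool" where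
  "rational_place emb v \<longleftrightarrow> place emb v \<and>
     (\<forall>y. y \<noteq> 0 \<longrightarrow> v y \<ge> 0 \<longrightarrow> (\<exists>c. y - emb c = 0 \<or> v (y - emb c) > 0))"

text \<open>value f(P) of a function at a rational point P (where f is regular)\<close>
definition eval_at :: "('k::field \<Rightarrow> 'f::field) \<Rightarrow> ('f \<Rightarrow> int) \<Rightarrow> 'f \<Rightarrow> 'k" where
  "eval_at emb v y = (THE c. y - emb c = 0 \<or> v (y - emb c) > 0)"

type_synonym 'f divisor = "('f \<Rightarrow> int) \<Rightarrow> int"

definition is_divisor :: "('k::field \<Rightarrow> 'f::field) \<Rightarrow> 'f divisor \<Rightarrow> bool" where
  "is_divisor emb E \<longleftrightarrow> finite {P. E P \<noteq> 0} \<and> (\<forall>P. E P \<noteq> 0 \<longrightarrow> place emb P)"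

definition rat_divisor :: "('k::field \<Rightarrow> 'f::field) \<Rightarrow> 'f divisor \<Rightarrow> bool" where
  "rat_divisor emb E \<longleftrightarrow> is_divisor emb E \<and> (\<forall>P. E P \<noteq> 0 \<longrightarrow> rational_place emb P)"

definition supp :: "'f divisor \<Rightarrow> ('f \<Rightarrow> int) set" where
  "supp E = {P. E P \<noteq> 0}"

text \<open>degree of a divisor supported on rational points (all have degree 1)\<close>
definition rdeg :: "'f divisor \<Rightarrow> int" where
  "rdeg E = (\<Sum>P\<in>supp E. E P)"

definition pdiv :: "('k::field \<Rightarrow> 'f::field) \<Rightarrow> 'f \<Rightarrow> 'f divisor" where
  "pdiv emb y = (\<lambda>P. if place emb P then P y else 0)"

definition dgcd :: "'f divisor \<Rightarrow> 'f divisor \<Rightarrow> 'f divisor" where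
  "dgcd A B = (\<lambda>P. min (A P) (B P))"

definition dlcm :: "'f divisor \<Rightarrow> 'f divisor \<Rightarrow> 'f divisor" where
  "dlcm A B = (\<lambda>P. max (A P) (B P))"

definition LL :: "('k::field \<Rightarrow> 'f::field) \<Rightarrow> 'f divisor \<Rightarrow> 'f set" where
  "LL emb E = {y. y = 0 \<or> (\<forall>P. place emb P \<longrightarrow> P y + E P \<ge> 0)}"

definition ell :: "('k::field \<Rightarrow> 'f::field) \<Rightarrow> 'f divisor \<Rightarrow> nat" where
  "ell emb E = vector_space.dim (\<lambda>c y. emb c * y) (LL emb E)"

text \<open>D given by its set of points Ps; vectors of k^n are indexed by the points of Ps
  (value 0 outside Ps)\<close>
definition point_divisor :: "('f \<Rightarrow> int) set \<Rightarrow> 'f divisor" where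
  "point_divisor Ps = (\<lambda>P. if P \<in> Ps then 1 else 0)"

definition ev :: "('k::field \<Rightarrow> 'f::field) \<Rightarrow> ('f \<Rightarrow> int) set \<Rightarrow> 'f \<Rightarrow> ('f \<Rightarrow> int) \<Rightarrow> 'k" where
  "ev emb Ps y = (\<lambda>P. if P \<in> Ps then eval_at emb P y else 0)"

definition AG_code :: "('k::field \<Rightarrow> 'f::field) \<Rightarrow> ('f \<Rightarrow> int) set \<Rightarrow> 'f divisor \<Rightarrow> (('f \<Rightarrow> int) \<Rightarrow> 'k) set" where
  "AG_code emb Ps E = ev emb Ps ` LL emb E"

definition star_prod :: "(('f \<Rightarrow> int) \<Rightarrow> 'k::field) \<Rightarrow> (('f \<Rightarrow> int) \<Rightarrow> 'k) set \<Rightarrow> (('f \<Rightarrow> int) \<Rightarrow> 'k) set" where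
  "star_prod w C = (\<lambda>c. \<lambda>P. w P * c P) ` C"

definition code_dim :: "(('f \<Rightarrow> int) \<Rightarrow> 'k::field) set \<Rightarrow> nat" where
  "code_dim C = vector_space.dim (\<lambda>(c::'k) v. (\<lambda>P. c * v P)) C"

end

theory Submission
  imports Defs "HOL-Library.FuncSet" "HOL-Library.Cardinality"
begin

text \<open>
  Put \<open>A = L(G)\<close> and \<open>B = L(H - (f)) = f L(H)\<close>, so that \<open>A \<inter> B = L(gcd)\<close> and the code in question is
  \<open>ev(A) \<inter> ev(B)\<close>. Evaluation is injective on \<open>A\<close>, which gives the lower bound. If \<open>ev a = ev b\<close>
  then \<open>a - b\<close> lies in \<open>L(lcm - D)\<close>, and it determines \<open>ev a\<close> up to \<open>ev(A \<inter> B)\<close>, which gives the upper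
  bound. As \<open>k\<close> is finite, dimensions are compared by counting elements. Since \<open>H - (f) \<le> H + J\<close>,
  all the spaces are finite. If \<open>D\<close> had infinitely many points its degree would take the junk value
  \<open>0\<close>, but then \<open>deg J < 0\<close> and there is no \<open>f\<close>.

  The real content is that \<open>L(E) = 0\<close> for a rational divisor \<open>E\<close> of negative degree. For
  transcendental \<open>x\<close> in \<open>L(E)\<close>, the rational zeros of \<open>x\<close>, say \<open>Z\<close> with multiplicity, yield \<open>Z\<close>
  functions independent over \<open>k[x]\<close>; made integral over \<open>k[x]\<close> and combined with polynomials of degree
  below \<open>l\<close> they fill \<open>q ^ (l * Z)\<close> elements of a space of dimension \<open>l M + O(1)\<close>, where \<open>M\<close> counts the
  poles. Hence \<open>Z \<le> M\<close>. That the dimension is finite at all rests on the existence of a pole for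
  every nonconstant function, a valuation ring supplied by Zorn's lemma that is discrete because the
  function field has finite degree over \<open>k(x)\<close>.
\<close>

section \<open>Families independent over a polynomial ring\<close>

text \<open>Phrased by coefficients rather than by \<open>degree\<close>, so that zero is included
  for every \<open>n\<close> and \<open>n\<close> is the exact dimension over a field.\<close>

definition polys_lt :: "nat \<Rightarrow> 'a::zero poly set" where
  "polys_lt n = {p. \<forall>i\<ge>n. coeff p i = 0}"

lemma polys_lt_0: "polys_lt 0 = {0 :: 'a::zero poly}"
  by (auto simp: polys_lt_def poly_eq_iff)

lemma polys_lt_Suc:
  "polys_lt (Suc n) = (\<lambda>(a, p). pCons a p) ` (UNIV \<times> polys_lt n)" (is "?L = ?R")
proof
  show "?L \<subseteq> ?R"
  proof
    fix p :: "'a poly" assume p: "p \<in> ?L"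
    obtain a r where ar: "p = pCons a r" by (cases p)
    have "coeff r i = 0" if "i \<ge> n" for i
      using p that unfolding polys_lt_def ar by (metis (mono_tags, lifting) Suc_le_mono coeff_pCons_Suc mem_Collect_eq)
    then show "p \<in> ?R" unfolding ar polys_lt_def by auto
  qed
  show "?R \<subseteq> ?L"
    by (auto simp: polys_lt_def coeff_pCons split: nat.splits)
qed

lemma finite_card_polys_lt:
  "finite (polys_lt n :: 'a::{finite,zero} poly set) \<and> card (polys_lt n :: 'a poly set) = CARD('a) ^ n"
proof (induction n)
  case 0 then show ?case by (simp add: polys_lt_0)
next
  case (Suc n)
  have "inj_on (\<lambda>(a :: 'a, p). pCons a p) (UNIV \<times> polys_lt n)"
    by (auto simp: inj_on_def)
  with Suc show ?case by (simp add: polys_lt_Suc card_image card_cartesian_product)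
qed

lemmas finite_polys_lt = finite_card_polys_lt[THEN conjunct1]
lemmas card_polys_lt = finite_card_polys_lt[THEN conjunct2]

lemma polys_lt_mono: "m \<le> n \<Longrightarrow> polys_lt m \<subseteq> polys_lt n"
  by (auto simp: polys_lt_def)

lemma zero_in_polys_lt: "0 \<in> polys_lt n"
  by (simp add: polys_lt_def)

lemma polys_lt_add:
  fixes p :: "'a::comm_monoid_add poly"
  shows "p \<in> polys_lt n \<Longrightarrow> r \<in> polys_lt n \<Longrightarrow> p + r \<in> polys_lt n"
  by (simp add: polys_lt_def)

lemma in_polys_lt_degree: "degree p < n \<Longrightarrow> p \<in> polys_lt n"
  by (simp add: polys_lt_def coeff_eq_0)

lemma polys_lt_mult:
  fixes p :: "'a::comm_semiring_0 poly"
  assumes "p \<in> polys_lt m" "r \<in> polys_lt n"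
  shows "p * r \<in> polys_lt (m + n)"
proof -
  have "coeff p i * coeff r (k - i) = 0" if "k \<ge> m + n" "i \<le> k" for i k
    using that assms by (cases "i \<ge> m") (auto simp: polys_lt_def)
  then show ?thesis by (auto simp: polys_lt_def coeff_mult intro!: sum.neutral)
qed

text \<open>Pairing \<open>h x\<close> with the difference of \<open>x\<close> from a chosen
  representative of its fibre is injective. This replaces rank-nullity and lets \<open>h\<close> be
  any map, linear or not.\<close>

lemma card_le_fibres:
  fixes X :: "'a::ab_group_add set"
  assumes "finite Y" "finite Z" "h ` X \<subseteq> Y"
    and "\<And>x x'. x \<in> X \<Longrightarrow> x' \<in> X \<Longrightarrow> h x = h x' \<Longrightarrow> x - x' \<in> Z"
  shows "finite X" "card X \<le> card Y * card Z"
proof -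
  define r where "r y = (SOME x. x \<in> X \<and> h x = y)" for y
  have r: "r (h x) \<in> X" "h (r (h x)) = h x" if "x \<in> X" for x
    using someI[of "\<lambda>x'. x' \<in> X \<and> h x' = h x" x] that unfolding r_def by auto
  let ?g = "\<lambda>x. (h x, x - r (h x))"
  have inj: "inj_on ?g X" by (auto simp: inj_on_def)
  have sub: "?g ` X \<subseteq> Y \<times> Z" using assms r by fastforce
  have fin: "finite (Y \<times> Z)" using assms by simp
  show "finite X" using inj sub fin by (meson finite_imageD finite_subset)
  show "card X \<le> card Y * card Z"
    using card_inj_on_le[OF inj sub fin] by (simp add: card_cartesian_product)
qed

section \<open>The embedded constant field and values of its polynomials\<close>

locale constants =
  fixes emb :: "'k::field \<Rightarrow> 'f::field"
  assumes hom: "field_hom emb"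
begin

lemma emb_1 [simp]: "emb 1 = 1" and emb_add: "emb (a + b) = emb a + emb b"
  and emb_mult: "emb (a * b) = emb a * emb b"
  using hom by (auto simp: field_hom_def)

lemma emb_0 [simp]: "emb 0 = 0"
  using emb_add[of 0 0] by (metis add_0 add_cancel_right_right)

lemma emb_minus: "emb (- a) = - emb a"
  using emb_add[of a "- a"] by (simp add: eq_neg_iff_add_eq_0 add.commute)

lemma emb_diff: "emb (a - b) = emb a - emb b"
  using emb_add[of a "- b"] by (simp add: emb_minus)

lemma emb_eq_0_iff [simp]: "emb a = 0 \<longleftrightarrow> a = 0"
  by (metis emb_0 emb_1 emb_mult mult_zero_left right_inverse zero_neq_one)

lemma emb_inverse: "inverse (emb c) = emb (inverse c)"
proof (cases "c = 0")
  case False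
  then have "emb c * emb (inverse c) = 1" by (simp flip: emb_mult)
  then show ?thesis by (rule inverse_unique)
qed simp

definition peval :: "'k poly \<Rightarrow> 'f \<Rightarrow> 'f" where
  "peval p x = poly (map_poly emb p) x"

lemma peval_0 [simp]: "peval 0 x = 0"
  by (simp add: peval_def)

lemma peval_pCons [simp]: "peval (pCons a p) x = emb a + x * peval p x"
  by (simp add: peval_def map_poly_pCons)

lemma peval_1 [simp]: "peval 1 x = 1"
  by (simp add: peval_def map_poly_1')

lemma peval_add: "peval (p + r) x = peval p x + peval r x"
  by (induction p r rule: poly_induct2) (auto simp: emb_add algebra_simps)

lemma peval_minus: "peval (- p) x = - peval p x"
  by (induction p) (auto simp: emb_minus)

lemma peval_diff: "peval (p - r) x = peval p x - peval r x"
  using peval_add[of p "- r" x] by (simp add: peval_minus)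

lemma peval_smult: "peval (smult a p) x = emb a * peval p x"
  by (induction p) (auto simp: emb_mult algebra_simps)

lemma peval_mult: "peval (p * r) x = peval p x * peval r x"
  by (induction p) (auto simp: peval_add peval_smult algebra_simps)

lemma transc_peval: "transc emb x \<longleftrightarrow> (\<forall>p. p \<noteq> 0 \<longrightarrow> peval p x \<noteq> 0)"
  by (simp add: transc_def peval_def)

text \<open>Linear independence over \<open>k[y]\<close>. A nonzero polynomial vanishing at
  \<open>y\<close> would itself give a relation, so nonempty independent families exist only for
  transcendental \<open>y\<close>.\<close>

definition indep_over :: "'f \<Rightarrow> 'i set \<Rightarrow> ('i \<Rightarrow> 'f) \<Rightarrow> bool" where
  "indep_over y T z \<longleftrightarrow> (\<forall>c. (\<Sum>j\<in>T. peval (c j) y * z j) = 0 \<longrightarrow> (\<forall>j\<in>T. c j = 0))"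

text \<open>A common power of \<^term>\<open>y\<close> can be cancelled from a relation, so only constant terms matter.\<close>

lemma indep_overI:
  assumes "y \<noteq> 0"
    and const: "\<And>c j. (\<Sum>j\<in>T. peval (c j) y * z j) = 0 \<Longrightarrow> j \<in> T \<Longrightarrow> coeff (c j) 0 = 0"
  shows "indep_over y T z"
proof -
  have "\<forall>c. (\<Sum>j\<in>T. peval (c j) y * z j) = 0 \<longrightarrow> (\<forall>j\<in>T. coeff (c j) n = 0)" for n
  proof (induction n)
    case 0 then show ?case using const by blast
  next
    case (Suc n)
    show ?case
    proof (intro allI impI ballI)
      fix c j assume c: "(\<Sum>j\<in>T. peval (c j) y * z j) = 0" and j: "j \<in> T"
      define d where "d j = poly_shift 1 (c j)" for j
      have cd: "c j = pCons 0 (d j)" if "j \<in> T" for j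
      proof (rule poly_eqI)
        fix i show "coeff (c j) i = coeff (pCons 0 (d j)) i"
          using const[OF c that] by (cases i) (auto simp: d_def coeff_poly_shift)
      qed
      have "(\<Sum>j\<in>T. peval (c j) y * z j) = y * (\<Sum>j\<in>T. peval (d j) y * z j)"
        by (simp add: sum_distrib_left cd mult.assoc)
      with c \<open>y \<noteq> 0\<close> have "(\<Sum>j\<in>T. peval (d j) y * z j) = 0" by simp
      with Suc j have "coeff (d j) n = 0" by blast
      then show "coeff (c j) (Suc n) = 0" by (simp add: cd[OF j])
    qed
  qed
  then show ?thesis unfolding indep_over_def by (simp add: poly_eq_iff)
qed

end

locale curve = constants emb for emb :: "'k::{finite,field} \<Rightarrow> 'f::field" +
  assumes ff: "function_field emb"
begin

lemma card_constants: "CARD('k) > 1"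
  using card_mono[of UNIV "{0, 1 :: 'k}"] by simp

text \<open>By independence, distinct coefficient families have distinct sums. This is the lower
  side of both counting arguments below.\<close>

lemma card_combinations:
  assumes "finite T" "indep_over y T z"
  shows "card ((\<lambda>c. \<Sum>j\<in>T. peval (c j) y * z j) ` PiE T (\<lambda>_. polys_lt l)) = CARD('k) ^ (l * card T)"
proof -
  have "inj_on (\<lambda>c. \<Sum>j\<in>T. peval (c j) y * z j) (PiE T (\<lambda>_. polys_lt l))"
  proof (rule inj_onI)
    fix c d assume c: "c \<in> PiE T (\<lambda>_. polys_lt l)" and d: "d \<in> PiE T (\<lambda>_. polys_lt l)"
      and eq: "(\<Sum>j\<in>T. peval (c j) y * z j) = (\<Sum>j\<in>T. peval (d j) y * z j)"
    have "(\<Sum>j\<in>T. peval (c j - d j) y * z j) = 0"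
      using eq by (simp add: peval_diff left_diff_distrib sum_subtractf)
    with assms(2) have "\<forall>j\<in>T. c j - d j = 0"
      unfolding indep_over_def by (auto dest: spec[of _ "\<lambda>j. c j - d j"])
    with c d show "c = d" by (intro PiE_ext) auto
  qed
  then show ?thesis
    using assms(1) by (simp add: card_image card_PiE card_polys_lt power_mult)
qed

section \<open>Finite degree of the function field over \<open>k(y)\<close>\<close>

lemma common_denominator:
  assumes "finite I" "\<And>i. i \<in> I \<Longrightarrow> g i \<in> rat_fun_field emb x"
    and x: "transc emb x"
  shows "\<exists>r. r \<noteq> 0 \<and> (\<forall>i\<in>I. \<exists>p. peval r x * g i = peval p x)"
  using assms(1,2)
proof (induction I rule: finite_induct)
  case empty then show ?case by (auto intro: exI[of _ 1])
next
  case (insert i I)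
  then obtain r where r: "r \<noteq> 0" "\<forall>i\<in>I. \<exists>p. peval r x * g i = peval p x" by auto
  obtain p s where s: "s \<noteq> 0" "g i = peval p x / peval s x"
    using insert.prems[of i] unfolding rat_fun_field_def peval_def by blast
  have "peval s x \<noteq> 0" using x s by (simp add: transc_peval)
  have "\<exists>p'. peval (r * s) x * g j = peval p' x" if "j \<in> insert i I" for j
  proof (cases "j = i")
    case True
    then have "peval (r * s) x * g j = peval (r * p) x"
      using s \<open>peval s x \<noteq> 0\<close> by (simp add: peval_mult)
    then show ?thesis by blast
  next
    case False
    with that r obtain p' where p': "peval r x * g j = peval p' x" by blast
    have "peval (r * s) x * g j = peval s x * (peval r x * g j)"
      by (simp add: peval_mult)
    also have "\<dots> = peval (s * p') x" by (simp add: p' peval_mult)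
    finally show ?thesis by blast
  qed
  with r s show ?case by (intro exI[of _ "r * s"]) auto
qed

text \<open>A bounded-degree piece of the \<open>k[x]\<close>-module generated by \<open>B\<close>.
  Different coefficients may give the same element, so its size is only bounded above.\<close>

definition lattice :: "'f \<Rightarrow> 'f set \<Rightarrow> nat \<Rightarrow> 'f set" where
  "lattice x B N = (\<lambda>s. \<Sum>b\<in>B. peval (s b) x * b) ` PiE B (\<lambda>_. polys_lt N)"

lemma latticeI:
  assumes "\<And>b. b \<in> B \<Longrightarrow> s b \<in> polys_lt N"
  shows "(\<Sum>b\<in>B. peval (s b) x * b) \<in> lattice x B N"
proof -
  have "(\<Sum>b\<in>B. peval (s b) x * b) = (\<Sum>b\<in>B. peval (restrict s B b) x * b)"
    by (rule sum.cong) auto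
  moreover have "restrict s B \<in> PiE B (\<lambda>_. polys_lt N)" using assms by auto
  ultimately show ?thesis unfolding lattice_def by blast
qed

lemma latticeE:
  assumes "u \<in> lattice x B N"
  obtains s where "\<forall>b\<in>B. s b \<in> polys_lt N" "u = (\<Sum>b\<in>B. peval (s b) x * b)"
  using assms unfolding lattice_def by auto

lemma lattice_card:
  assumes "finite B"
  shows "finite (lattice x B N)" "card (lattice x B N) \<le> CARD('k) ^ (N * card B)"
proof -
  have fin: "finite (PiE B (\<lambda>_. polys_lt N :: 'k poly set))"
    using assms by (simp add: finite_PiE finite_polys_lt)
  then show "finite (lattice x B N)" unfolding lattice_def by simp
  show "card (lattice x B N) \<le> CARD('k) ^ (N * card B)"
    unfolding lattice_def using card_image_le[OF fin] assms
    by (simp add: card_PiE card_polys_lt power_mult)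
qed

lemma lattice_add:
  assumes "u \<in> lattice x B N" "v \<in> lattice x B N"
  shows "u + v \<in> lattice x B N"
proof -
  obtain s where s: "\<forall>b\<in>B. s b \<in> polys_lt N" "u = (\<Sum>b\<in>B. peval (s b) x * b)"
    by (rule latticeE[OF assms(1)])
  obtain s' where s': "\<forall>b\<in>B. s' b \<in> polys_lt N" "v = (\<Sum>b\<in>B. peval (s' b) x * b)"
    by (rule latticeE[OF assms(2)])
  have "u + v = (\<Sum>b\<in>B. peval (s b + s' b) x * b)"
    by (simp add: s(2) s'(2) peval_add ring_distribs sum.distrib)
  also have "\<dots> \<in> lattice x B N" by (intro latticeI polys_lt_add bspec[OF s(1)] bspec[OF s'(1)])
  finally show ?thesis .
qed

lemma lattice_0: "0 \<in> lattice x B N"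
  using latticeI[of B "\<lambda>_. 0" N x] by (simp add: zero_in_polys_lt)

lemma lattice_sum:
  "(\<And>i. i \<in> I \<Longrightarrow> u i \<in> lattice x B N) \<Longrightarrow> sum u I \<in> lattice x B N"
  by (induction I rule: infinite_finite_induct) (auto intro: lattice_add lattice_0)

lemma lattice_peval:
  assumes "p \<in> polys_lt m" "u \<in> lattice x B N"
  shows "peval p x * u \<in> lattice x B (m + N)"
proof -
  obtain s where s: "\<forall>b\<in>B. s b \<in> polys_lt N" "u = (\<Sum>b\<in>B. peval (s b) x * b)"
    by (rule latticeE[OF assms(2)])
  have "peval p x * u = (\<Sum>b\<in>B. peval (p * s b) x * b)"
    by (simp add: s(2) peval_mult sum_distrib_left mult.assoc)
  also have "\<dots> \<in> lattice x B (m + N)" by (intro latticeI polys_lt_mult bspec[OF s(1)] assms)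
  finally show ?thesis .
qed

lemma lattice_mono: "m \<le> n \<Longrightarrow> lattice x B m \<subseteq> lattice x B n"
  using polys_lt_mono unfolding lattice_def by (blast intro: PiE_mono[THEN subsetD])

lemma lattice_emb: "u \<in> lattice x B N \<Longrightarrow> emb a * u \<in> lattice x B N"
proof -
  assume "u \<in> lattice x B N"
  then obtain s where s: "\<forall>b\<in>B. s b \<in> polys_lt N" "u = (\<Sum>b\<in>B. peval (s b) x * b)"
    by (rule latticeE)
  have "emb a * u = (\<Sum>b\<in>B. peval (smult a (s b)) x * b)"
    by (simp add: s(2) peval_smult sum_distrib_left mult.assoc)
  also have "\<dots> \<in> lattice x B N" using s(1) by (intro latticeI) (simp add: polys_lt_def)
  finally show ?thesis .
qed

text \<open>The finitely many coordinates of the elements of \<open>W\<close> in \<open>k(x)\<close>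
  share one denominator \<open>r\<close>, and \<open>N\<close> exceeds the degrees of all
  numerators.\<close>

lemma lattice_exhausts:
  assumes x: "transc emb x" and B: "finite B"
    and gen: "\<And>y. \<exists>c. (\<forall>b\<in>B. c b \<in> rat_fun_field emb x) \<and> y = (\<Sum>b\<in>B. c b * b)"
    and W: "finite W"
  shows "\<exists>r N. r \<noteq> 0 \<and> (\<forall>w\<in>W. peval r x * w \<in> lattice x B N)"
proof -
  have "\<forall>w. \<exists>c. (\<forall>b\<in>B. c b \<in> rat_fun_field emb x) \<and> w = (\<Sum>b\<in>B. c b * b)"
    by (rule allI) (rule gen)
  from choice[OF this] obtain c where
    c: "\<forall>w. (\<forall>b\<in>B. c w b \<in> rat_fun_field emb x) \<and> w = (\<Sum>b\<in>B. c w b * b)" ..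
  have cw: "(\<Sum>b\<in>B. c w b * b) = w" for w
    using c by (rule allE[of _ w]) (erule conjE, erule sym)
  have cr: "c w b \<in> rat_fun_field emb x" if "b \<in> B" for w b
    using c that by blast
  have "\<exists>r. r \<noteq> 0 \<and> (\<forall>i\<in>W \<times> B. \<exists>p. peval r x * c (fst i) (snd i) = peval p x)"
    by (rule common_denominator[OF _ _ x]) (use B W cr in auto)
  then obtain r where r: "r \<noteq> 0" "\<forall>i\<in>W \<times> B. \<exists>p. peval r x * c (fst i) (snd i) = peval p x"
    by blast
  define p where "p w b = (SOME p. peval r x * c w b = peval p x)" for w b
  have p: "peval r x * c w b = peval (p w b) x" if "w \<in> W" "b \<in> B" for w b
    unfolding p_def by (rule someI_ex) (use r(2) that in force)
  define N where "N = Suc (Max ((\<lambda>(w, b). degree (p w b)) ` (W \<times> B)))"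
  have N: "p w b \<in> polys_lt N" if "w \<in> W" "b \<in> B" for w b
  proof (rule in_polys_lt_degree)
    have "degree (p w b) \<le> Max ((\<lambda>(w, b). degree (p w b)) ` (W \<times> B))"
      using that W B by (intro Max_ge) auto
    then show "degree (p w b) < N" unfolding N_def by simp
  qed
  have "peval r x * w \<in> lattice x B N" if "w \<in> W" for w
  proof -
    have "peval r x * w = (\<Sum>b\<in>B. peval r x * c w b * b)"
      using cw[of w] by (simp add: mult.assoc flip: sum_distrib_left)
    also have "\<dots> = (\<Sum>b\<in>B. peval (p w b) x * b)" using p that by simp
    also have "\<dots> \<in> lattice x B N" using N that by (intro latticeI) auto
    finally show ?thesis .
  qed
  with r show ?thesis by blast
qed

text \<open>The function field has finite degree over \<open>k(y)\<close>: after clearing denominators by a power of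
  \<open>r(x)\<close>, polynomials in \<open>y\<close> of degree below \<open>l\<close> act within a lattice whose \<open>k\<close>-dimension grows like
  \<open>m l card B\<close>.\<close>

lemma indep_over_bounded:
  "\<exists>K. \<forall>n z. indep_over y {..<n::nat} z \<longrightarrow> n \<le> K"
proof -
  obtain x B where x: "transc emb x" and B: "finite B"
    and gen: "\<forall>y. \<exists>c. (\<forall>b\<in>B. c b \<in> rat_fun_field emb x) \<and> y = (\<Sum>b\<in>B. c b * b)"
    using ff unfolding function_field_def by (elim conjE exE)
  note exhaust = lattice_exhausts[OF x B gen[rule_format]]
  obtain r m0 where r: "r \<noteq> 0" and m0: "\<And>b. b \<in> B \<Longrightarrow> peval r x * (y * b) \<in> lattice x B m0"
    using exhaust[of "(\<lambda>b. y * b) ` B"] B by auto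
  \<comment> \<open>Enlarging \<open>m\<close> puts \<open>r\<close> itself into
    \<open>polys_lt m\<close>, so that a spare factor \<open>r(x)\<close> costs no more degree than
    a multiplication by \<open>y\<close>.\<close>
  define m where "m = max m0 (Suc (degree r))"
  have m: "peval r x * (y * b) \<in> lattice x B m" if "b \<in> B" for b
    using m0[OF that] lattice_mono[of m0 m x B] by (auto simp: m_def)
  have rm: "r \<in> polys_lt m" by (rule in_polys_lt_degree) (simp add: m_def)
  have rx: "peval r x \<noteq> 0" using x r by (simp add: transc_peval)
  have mult_y: "peval r x * (y * u) \<in> lattice x B (m + N)" if u: "u \<in> lattice x B N" for u N
  proof -
    obtain s where s: "\<forall>b\<in>B. s b \<in> polys_lt N" "u = (\<Sum>b\<in>B. peval (s b) x * b)"
      by (rule latticeE[OF u])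
    have "peval r x * (y * u) = (\<Sum>b\<in>B. peval (s b) x * (peval r x * (y * b)))"
      by (simp add: s(2) sum_distrib_left mult_ac)
    also have "\<dots> \<in> lattice x B (N + m)"
      by (intro lattice_sum lattice_peval bspec[OF s(1)] m)
    finally show ?thesis by (simp add: add.commute)
  qed
  have poly_y: "peval r x ^ l * (peval p y * u) \<in> lattice x B (l * m + N)"
    if u: "u \<in> lattice x B N" and p: "p \<in> polys_lt l" for u N l p
    using p
  proof (induction l arbitrary: p)
    case 0
    then show ?case by (simp add: polys_lt_0 lattice_0)
  next
    case (Suc l)
    then obtain a p' where p': "p = pCons a p'" "p' \<in> polys_lt l" by (auto simp: polys_lt_Suc)
    have 1: "peval r x ^ i * u \<in> lattice x B (i * m + N)" for i
    proof (induction i)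
      case 0
      then show ?case using u by simp
    next
      case (Suc i)
      show ?case using lattice_peval[OF rm Suc] by (simp add: mult.assoc add.assoc)
    qed
    have "peval r x ^ Suc l * (peval p y * u) = emb a * (peval r x ^ Suc l * u)
        + peval r x * (y * (peval r x ^ l * (peval p' y * u)))"
      by (simp add: p' algebra_simps)
    moreover have "emb a * (peval r x ^ Suc l * u) \<in> lattice x B (Suc l * m + N)"
      by (intro lattice_emb 1)
    moreover have "peval r x * (y * (peval r x ^ l * (peval p' y * u))) \<in> lattice x B (Suc l * m + N)"
      using mult_y[OF Suc.IH[OF p'(2)]] by (simp add: add.assoc)
    ultimately show ?case using lattice_add by simp
  qed
  have "n \<le> m * card B" if ind: "indep_over y {..<n} z" for n z
  proof (rule ccontr)
    assume contra: "\<not> n \<le> m * card B"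
    obtain e N where e: "e \<noteq> 0" and N: "\<And>j. j < n \<Longrightarrow> peval e x * z j \<in> lattice x B N"
      using exhaust[of "z ` {..<n}"] by auto
    have ex: "peval e x \<noteq> 0" using x e by (simp add: transc_peval)
    \<comment> \<open>With \<open>n \<ge> m * card B + 1\<close> the comparison of exponents leaves
      \<open>l \<le> N * card B\<close>, which this choice rules out.\<close>
    define l where "l = Suc (N * card B)"
    let ?S = "(\<lambda>c. \<Sum>j<n. peval (c j) y * z j) ` PiE {..<n} (\<lambda>_. polys_lt l)"
    let ?f = "\<lambda>u. peval r x ^ l * peval e x * u"
    have "?f ` ?S \<subseteq> lattice x B (l * m + N)"
    proof clarify
      fix c assume c: "c \<in> PiE {..<n} (\<lambda>_. polys_lt l :: 'k poly set)"
      have "?f (\<Sum>j<n. peval (c j) y * z j)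
          = (\<Sum>j<n. peval r x ^ l * (peval (c j) y * (peval e x * z j)))"
        by (simp add: sum_distrib_left mult_ac)
      also have "\<dots> \<in> lattice x B (l * m + N)"
        using c by (intro lattice_sum poly_y N) auto
      finally show "?f (\<Sum>j<n. peval (c j) y * z j) \<in> lattice x B (l * m + N)" .
    qed
    moreover have "inj_on ?f ?S" using rx ex by (auto simp: inj_on_def)
    ultimately have "card ?S \<le> card (lattice x B (l * m + N))"
      by (intro card_inj_on_le lattice_card(1)[OF B])
    also have "\<dots> \<le> CARD('k) ^ ((l * m + N) * card B)" by (rule lattice_card(2)[OF B])
    finally have "CARD('k) ^ (l * n) \<le> CARD('k) ^ ((l * m + N) * card B)"
      using card_combinations[OF _ ind, of l] by simp
    moreover have "CARD('k) > 1"
      by (rule card_constants)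
    ultimately have "l * n \<le> (l * m + N) * card B" by simp
    moreover have "l * n \<ge> l * (m * card B + 1)" using contra by (intro mult_le_mono) auto
    ultimately show False unfolding l_def by (simp add: algebra_simps)
  qed
  then show ?thesis by blast
qed

end

section \<open>Valuations and residues\<close>

text \<open>Order at least \<open>n\<close>, with zero counted as having infinite order; the
  convention \<open>v 0 = 0\<close> would otherwise force a case split in every estimate.\<close>

definition vge :: "('f::zero \<Rightarrow> int) \<Rightarrow> int \<Rightarrow> 'f \<Rightarrow> bool" where
  "vge v n y \<longleftrightarrow> y = 0 \<or> v y \<ge> n"

lemma vge_0 [simp]: "vge v n 0"
  by (simp add: vge_def)

lemma vge_mono: "vge v n y \<Longrightarrow> m \<le> n \<Longrightarrow> vge v m y"
  by (auto simp: vge_def)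

context constants
begin

context
  fixes v assumes v: "place emb v"
begin

lemma place_0 [simp]: "v 0 = 0"
  using v by (simp add: place_def)

lemma place_mult: "x \<noteq> 0 \<Longrightarrow> y \<noteq> 0 \<Longrightarrow> v (x * y) = v x + v y"
  using v by (simp add: place_def)

lemma place_emb [simp]: "v (emb c) = 0"
  using v by (cases "c = 0") (auto simp: place_def)

lemma place_1 [simp]: "v 1 = 0"
  using place_emb[of 1] by simp

lemma place_inverse: "v (inverse x) = - v x"
proof (cases "x = 0")
  case True then show ?thesis by simp
next
  case False
  then show ?thesis using place_mult[of x "inverse x"] by simp
qed

lemma place_divide: "x \<noteq> 0 \<Longrightarrow> y \<noteq> 0 \<Longrightarrow> v (x / y) = v x - v y"
  by (simp add: divide_inverse place_mult place_inverse)

lemma place_power: "v (x ^ n) = int n * v x"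
proof (cases "x = 0")
  case True then show ?thesis by (cases n) auto
next
  case False
  then show ?thesis by (induction n) (auto simp: place_mult algebra_simps)
qed

lemma place_prod: "(\<And>i. i \<in> I \<Longrightarrow> g i \<noteq> 0) \<Longrightarrow> v (\<Prod>i\<in>I. g i) = (\<Sum>i\<in>I. v (g i))"
  by (induction I rule: infinite_finite_induct) (auto simp: place_mult)

lemma vge_add: "vge v n x \<Longrightarrow> vge v n y \<Longrightarrow> vge v n (x + y)"
  using v unfolding vge_def place_def by (metis add.left_neutral add.right_neutral min.bounded_iff order_trans)

lemma vge_mult: "vge v m x \<Longrightarrow> vge v n y \<Longrightarrow> vge v (m + n) (x * y)"
  by (cases "x = 0"; cases "y = 0") (auto simp: vge_def place_mult)

lemma vge_emb: "vge v 0 (emb c)"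
  by (simp add: vge_def)

lemma vge_minus: "vge v n x \<Longrightarrow> vge v n (- x)"
  using vge_mult[OF vge_emb[of "- 1"]] by (simp add: emb_minus)

lemma vge_diff: "vge v n x \<Longrightarrow> vge v n y \<Longrightarrow> vge v n (x - y)"
  using vge_add[OF _ vge_minus, of n x y] by simp

lemma vge_sum: "(\<And>i. i \<in> I \<Longrightarrow> vge v n (g i)) \<Longrightarrow> vge v n (sum g I)"
  by (induction I rule: infinite_finite_induct) (auto intro: vge_add)

lemma vge_power: "vge v 0 x \<Longrightarrow> vge v 0 (x ^ n)"
  by (cases "x = 0") (auto simp: vge_def place_power)

lemma vge_peval: "vge v 0 x \<Longrightarrow> vge v 0 (peval p x)"
proof (induction p)
  case (pCons a p)
  then show ?case using vge_mult[of 0 x 0 "peval p x"] by (simp add: vge_add vge_emb)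
qed simp

lemma place_add_eq:
  assumes "v x = n" "x \<noteq> 0" "vge v (n + 1) y"
  shows "x + y \<noteq> 0" "v (x + y) = n"
proof -
  show 0: "x + y \<noteq> 0"
    using assms vge_minus[OF assms(3)] by (auto simp: vge_def eq_neg_iff_add_eq_0[symmetric])
  have "vge v n (x + y)"
    using assms by (intro vge_add) (auto simp: vge_def)
  moreover have "\<not> vge v (n + 1) (x + y)"
    using vge_diff[OF _ assms(3), of "x + y"] assms by (auto simp: vge_def)
  ultimately show "v (x + y) = n" using 0 by (auto simp: vge_def)
qed

end

text \<open>Two candidates differ by a constant, which has order \<open>0\<close> unless it is zero.
  This makes the description in \<open>eval_at\<close> well defined.\<close>

lemma rational_residue:
  assumes "rational_place emb v" "vge v 0 y"
  shows "\<exists>!c. vge v 1 (y - emb c)"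
proof -
  have v: "place emb v" using assms by (simp add: rational_place_def)
  have "\<exists>c. vge v 1 (y - emb c)"
  proof (cases "y = 0")
    case True then show ?thesis by (intro exI[of _ 0]) simp
  next
    case False
    then show ?thesis using assms unfolding rational_place_def vge_def
      by (metis zless_imp_add1_zle add.left_neutral)
  qed
  moreover have "c = d" if "vge v 1 (y - emb c)" "vge v 1 (y - emb d)" for c d
    using vge_diff[OF v that] place_emb[OF v, of "d - c"]
    by (auto simp: vge_def emb_diff[symmetric])
  ultimately show ?thesis by blast
qed

lemma eval_at_eqI:
  assumes "rational_place emb v" "vge v 0 y" "vge v 1 (y - emb c)"
  shows "eval_at emb v y = c"
proof -
  have "(y - emb c = 0 \<or> v (y - emb c) > 0) \<longleftrightarrow> vge v 1 (y - emb c)" for c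
    by (auto simp: vge_def)
  then show ?thesis
    unfolding eval_at_def using rational_residue[OF assms(1,2)] assms(3) by auto
qed

lemma eval_at:
  assumes "rational_place emb v" "vge v 0 y"
  shows "vge v 1 (y - emb (eval_at emb v y))"
  using rational_residue[OF assms] eval_at_eqI[OF assms] by blast

lemma eval_at_add:
  assumes v: "rational_place emb v" "vge v 0 y" "vge v 0 z"
  shows "eval_at emb v (y + z) = eval_at emb v y + eval_at emb v z"
proof -
  have p: "place emb v" using v by (simp add: rational_place_def)
  from vge_add[OF p eval_at[OF v(1,2)] eval_at[OF v(1,3)]] show ?thesis
    by (intro eval_at_eqI v vge_add[OF p]) (simp add: emb_add algebra_simps)
qed

lemma eval_at_mult:
  assumes v: "rational_place emb v" "vge v 0 y" "vge v 0 z"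
  shows "eval_at emb v (y * z) = eval_at emb v y * eval_at emb v z"
proof (rule eval_at_eqI[OF v(1)])
  have p: "place emb v" using v by (simp add: rational_place_def)
  show "vge v 0 (y * z)" using vge_mult[OF p v(2,3)] by simp
  let ?a = "eval_at emb v y" and ?b = "eval_at emb v z"
  have "vge v 1 ((y - emb ?a) * z)" using vge_mult[OF p eval_at[OF v(1,2)] v(3)] by simp
  moreover have "vge v 1 (emb ?a * (z - emb ?b))"
    using vge_mult[OF p vge_emb[OF p] eval_at[OF v(1,3)]] by simp
  ultimately have "vge v 1 ((y - emb ?a) * z + emb ?a * (z - emb ?b))" by (rule vge_add[OF p])
  then show "vge v 1 (y * z - emb (?a * ?b))" by (simp add: algebra_simps emb_mult)
qed

lemma eval_at_emb:
  assumes "rational_place emb v"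
  shows "eval_at emb v (emb c) = c"
  by (intro eval_at_eqI assms vge_emb) (use assms in \<open>auto simp: rational_place_def\<close>)

lemma eval_at_eq_0_iff:
  assumes "rational_place emb v" "vge v 0 y"
  shows "eval_at emb v y = 0 \<longleftrightarrow> vge v 1 y"
  using eval_at[OF assms] eval_at_eqI[OF assms, of 0] by auto

end

section \<open>Integrality over \<open>k[y]\<close>\<close>

context curve
begin

lemma algebraic_or_transc:
  obtains c where "y = emb c" | "transc emb y"
  using ff unfolding function_field_def transc_def by blast

text \<open>If \<open>c\<^sub>J\<close> is the leading coefficient of an algebraic relation for \<^term>\<open>w\<close> over \<open>k[y]\<close>, then
  \<open>c\<^sub>J w\<close> is integral over \<open>k[y]\<close>.\<close>

lemma integral_multiple:
  assumes y: "transc emb y"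
  shows "\<exists>d. d \<noteq> 0 \<and> (\<forall>v. place emb v \<longrightarrow> vge v 0 y \<longrightarrow> vge v 0 (peval d y * w))"
proof -
  obtain K where K: "\<And>n z. indep_over y {..<n::nat} z \<Longrightarrow> n \<le> K"
    using indep_over_bounded by blast
  \<comment> \<open>The powers \<open>w ^ 0, ..., w ^ K\<close> are one more than an independent
    family can have.\<close>
  from K[of "Suc K" "\<lambda>j. w ^ j"] obtain c where
    c: "(\<Sum>j<Suc K. peval (c j) y * w ^ j) = 0" and c0: "\<exists>j<Suc K. c j \<noteq> 0"
    unfolding indep_over_def by fastforce
  define J where "J = Max {j. j < Suc K \<and> c j \<noteq> 0}"
  have "J \<in> {j. j < Suc K \<and> c j \<noteq> 0}"
    unfolding J_def using c0 by (intro Max_in) auto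
  then have J: "J < Suc K" "c J \<noteq> 0" by auto
  have Jmax: "c j = 0" if "j < Suc K" "j > J" for j
    using Max_ge[of "{j. j < Suc K \<and> c j \<noteq> 0}" j] that unfolding J_def by fastforce
  have "(\<Sum>j<Suc K. peval (c j) y * w ^ j) = (\<Sum>j<Suc J. peval (c j) y * w ^ j)"
    by (rule sum.mono_neutral_right) (use J Jmax in auto)
  with c have rel: "peval (c J) y * w ^ J = - (\<Sum>j<J. peval (c j) y * w ^ j)"
    by (simp add: eq_neg_iff_add_eq_0 add.commute)
  have cJ: "peval (c J) y \<noteq> 0" using y J by (simp add: transc_peval)
  have J0: "J > 0"
    using rel cJ by (cases J) auto
  define d u where "d = peval (c J) y" and "u = d * w"
  have d0: "d \<noteq> 0" using cJ by (simp add: d_def)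
  \<comment> \<open>Multiplying the relation by \<open>d ^ (J - 1)\<close> turns it into a monic
    equation for \<open>u\<close>.\<close>
  have "u ^ J = d ^ (J - 1) * (d * w ^ J)"
    using J0 by (cases J) (auto simp: u_def power_mult_distrib)
  also have "\<dots> = - (\<Sum>j<J. d ^ (J - 1) * (peval (c j) y * w ^ j))"
    using rel by (simp add: d_def sum_distrib_left)
  also have "(\<Sum>j<J. d ^ (J - 1) * (peval (c j) y * w ^ j))
      = (\<Sum>j<J. (peval (c j) y * d ^ (J - 1 - j)) * u ^ j)"
  proof (rule sum.cong)
    fix j assume "j \<in> {..<J}"
    then have "d ^ (J - 1) = d ^ (J - 1 - j) * d ^ j" by (simp flip: power_add)
    then show "d ^ (J - 1) * (peval (c j) y * w ^ j) = (peval (c j) y * d ^ (J - 1 - j)) * u ^ j"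
      by (simp add: u_def power_mult_distrib)
  qed simp
  finally have uJ: "u ^ J = - (\<Sum>j<J. (peval (c j) y * d ^ (J - 1 - j)) * u ^ j)" .
  have "vge v 0 u" if v: "place emb v" "vge v 0 y" for v
  proof (rule ccontr)
    assume "\<not> vge v 0 u"
    then have u: "u \<noteq> 0" "v u < 0" by (auto simp: vge_def)
    \<comment> \<open>If \<open>u\<close> has a pole, every term of lower degree has order at least
      \<open>(J - 1) * v u\<close>, which is greater than the order \<open>J * v u\<close> of
      \<open>u ^ J\<close>.\<close>
    have "vge v (int (J - 1) * v u) ((peval (c j) y * d ^ (J - 1 - j)) * u ^ j)" if "j < J" for j
    proof -
      have "vge v 0 (peval (c j) y * d ^ (J - 1 - j))"
        using vge_mult[OF v(1) vge_peval[OF v] vge_power[OF v(1) vge_peval[OF v]]]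
        by (simp add: d_def)
      moreover have "int (J - 1) * v u \<le> int j * v u"
        using that u by (intro mult_right_mono_neg) auto
      then have "vge v (int (J - 1) * v u) (u ^ j)"
        by (simp add: vge_def place_power[OF v(1)])
      ultimately show ?thesis using vge_mult[OF v(1)] by fastforce
    qed
    then have "vge v (int (J - 1) * v u) (u ^ J)"
      unfolding uJ by (intro vge_minus vge_sum v) auto
    with u J0 have "int (J - 1) * v u \<le> int J * v u" by (simp add: vge_def place_power[OF v(1)])
    then have "v u \<ge> 0" using J0 by (simp add: of_nat_diff algebra_simps)
    with u show False by simp
  qed
  then show ?thesis using J(2) unfolding u_def d_def by blast
qed

end

section \<open>Discreteness of valuation rings\<close>

definition (in constants) subalgebra :: "'f set \<Rightarrow> bool" where
  "subalgebra R \<longleftrightarrow> range emb \<subseteq> R \<and> (\<forall>a\<in>R. \<forall>b\<in>R. a + b \<in> R \<and> a * b \<in> R)"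

context constants
begin

context
  fixes R assumes R: "subalgebra R"
begin

lemma subalgebra_emb: "emb c \<in> R"
  using R by (auto simp: subalgebra_def)

lemma subalgebra_add: "a \<in> R \<Longrightarrow> b \<in> R \<Longrightarrow> a + b \<in> R"
  and subalgebra_mult: "a \<in> R \<Longrightarrow> b \<in> R \<Longrightarrow> a * b \<in> R"
  using R by (auto simp: subalgebra_def)

lemma subalgebra_0: "0 \<in> R" and subalgebra_1: "1 \<in> R"
  using subalgebra_emb[of 0] subalgebra_emb[of 1] by auto

lemma subalgebra_minus: "a \<in> R \<Longrightarrow> - a \<in> R"
  using subalgebra_mult[OF subalgebra_emb[of "- 1"]] by (simp add: emb_minus)

lemma subalgebra_diff: "a \<in> R \<Longrightarrow> b \<in> R \<Longrightarrow> a - b \<in> R"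
  using subalgebra_add[OF _ subalgebra_minus, of a b] by simp

lemma subalgebra_power: "a \<in> R \<Longrightarrow> a ^ n \<in> R"
  by (induction n) (auto intro: subalgebra_mult subalgebra_1)

lemma subalgebra_peval: "a \<in> R \<Longrightarrow> peval p a \<in> R"
  by (induction p) (auto intro: subalgebra_add subalgebra_mult subalgebra_0 subalgebra_emb)

lemma subalgebra_sum: "(\<And>i. i \<in> I \<Longrightarrow> g i \<in> R) \<Longrightarrow> sum g I \<in> R"
  by (induction I rule: infinite_finite_induct) (auto intro: subalgebra_add subalgebra_0)

end

end

section \<open>The maximal ideal of a valuation ring\<close>

locale valuation_ring = constants emb for emb :: "'k::field \<Rightarrow> 'f::field" +
  fixes R :: "'f set"
  assumes R: "subalgebra R" and val: "z \<in> R \<or> inverse z \<in> R"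
begin

text \<open>The maximal ideal of \<open>R\<close>. A missing inverse already puts \<open>z\<close>
  into \<open>R\<close> by \<open>val\<close>; zero is listed separately because
  \<open>inverse 0 = 0\<close> lies in \<open>R\<close>.\<close>

definition nonunit :: "'f \<Rightarrow> bool" where
  "nonunit z \<longleftrightarrow> z = 0 \<or> inverse z \<notin> R"

lemma nonunit_in: "nonunit z \<Longrightarrow> z \<in> R"
  using val[of z] subalgebra_0[OF R] by (auto simp: nonunit_def)

lemma nonunit_0 [simp]: "nonunit 0"
  by (simp add: nonunit_def)

lemma nonunit_mult:
  assumes "r \<in> R" "nonunit z"
  shows "nonunit (r * z)"
proof (cases "r * z = 0")
  case False
  have "inverse z = r * inverse (r * z)" using False by (simp add: field_simps)
  then have "inverse (r * z) \<in> R \<Longrightarrow> inverse z \<in> R"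
    using subalgebra_mult[OF R assms(1)] by metis
  then show ?thesis using assms False unfolding nonunit_def by auto
qed auto

text \<open>One of \<open>a / b\<close> and \<open>b / a\<close> lies in \<open>R\<close>, so the
  sum is a multiple of one summand by an element of \<open>R\<close>.\<close>

lemma nonunit_add:
  assumes "nonunit a" "nonunit b"
  shows "nonunit (a + b)"
proof -
  have *: "nonunit (a + b)" if "nonunit b" "a / b \<in> R" "b \<noteq> 0" for a b
  proof -
    have "a + b = (a / b + 1) * b" using that by (simp add: field_simps)
    also have "nonunit \<dots>" using that by (intro nonunit_mult subalgebra_add subalgebra_1 R)
    finally show ?thesis .
  qed
  show ?thesis
    using val[of "a / b"] *[of b a] *[of a b] assms
    by (cases "a = 0"; cases "b = 0") (auto simp: add.commute)
qed

lemma nonunit_minus: "nonunit a \<Longrightarrow> nonunit (- a)"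
  using nonunit_mult[OF subalgebra_minus[OF R subalgebra_1[OF R]], of a] by simp

lemma nonunit_sum: "(\<And>i. i \<in> I \<Longrightarrow> nonunit (g i)) \<Longrightarrow> nonunit (sum g I)"
  by (induction I rule: infinite_finite_induct) (auto intro: nonunit_add)

lemma not_nonunit_emb: "c \<noteq> 0 \<Longrightarrow> \<not> nonunit (emb c)"
  using subalgebra_emb[OF R] by (auto simp: nonunit_def emb_inverse)

text \<open>Orders fall along the chain. In a relation let \<open>J\<close> be the last index whose
  coefficient has nonzero constant term and divide by \<open>z J\<close>: earlier terms become
  nonunits by the chain, later ones by their factor \<open>y\<close>, and so a nonzero constant
  would be a nonunit.\<close>

lemma chain_indep:
  assumes y: "nonunit y" "y \<noteq> 0"
    and z: "\<And>i. i < n \<Longrightarrow> z i \<noteq> 0 \<and> nonunit (z i) \<and> y / z i \<in> R"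
    and chain: "\<And>i j. i < j \<Longrightarrow> j < n \<Longrightarrow> nonunit (z i / z j)"
  shows "indep_over y {..<n::nat} z"
proof (rule indep_overI[OF y(2)], rule ccontr)
  fix c j0
  assume c: "(\<Sum>j<n. peval (c j) y * z j) = 0" and j0: "j0 \<in> {..<n}" "coeff (c j0) 0 \<noteq> 0"
  define J where "J = Max {j. j < n \<and> coeff (c j) 0 \<noteq> 0}"
  have "J \<in> {j. j < n \<and> coeff (c j) 0 \<noteq> 0}"
    unfolding J_def using j0 by (intro Max_in) auto
  then have J: "J < n" "coeff (c J) 0 \<noteq> 0" by auto
  have Jmax: "coeff (c j) 0 = 0" if "j < n" "j > J" for j
    using Max_ge[of "{j. j < n \<and> coeff (c j) 0 \<noteq> 0}" j] that unfolding J_def by fastforce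
  have yR: "y \<in> R" using y nonunit_in by blast
  have pR: "peval p y \<in> R" for p by (rule subalgebra_peval[OF R yR])
  have zJ: "z J \<noteq> 0" using z J by blast
  obtain a p where cJ: "c J = pCons a p" by (cases "c J")
  have term_nonunit: "nonunit (peval (c i) y * z i / z J)" if i: "i \<in> {..<n} - {J}" for i
  proof (cases "i < J")
    case True
    then show ?thesis using nonunit_mult[OF pR chain[OF True J(1)]] by simp
  next
    case False
    obtain d where d: "c i = pCons 0 d" using Jmax[of i] i False by (cases "c i") auto
    have "nonunit (peval d y * (y / z J) * z i)"
      using i z J(1) by (intro nonunit_mult subalgebra_mult[OF R] pR) auto
    then show ?thesis by (simp add: d mult_ac)
  qed
  have "0 = (\<Sum>j<n. peval (c j) y * z j) / z J" using c by simp
  also have "\<dots> = (\<Sum>j<n. peval (c j) y * z j / z J)" by (simp add: sum_divide_distrib)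
  also have "\<dots> = peval (c J) y + (\<Sum>i\<in>{..<n} - {J}. peval (c i) y * z i / z J)"
    using J zJ by (subst sum.remove[of _ J]) auto
  finally have "emb a = - ((\<Sum>i\<in>{..<n} - {J}. peval (c i) y * z i / z J) + peval p y * y)"
    by (simp add: cJ algebra_simps eq_neg_iff_add_eq_0)
  moreover have "nonunit \<dots>"
    by (intro nonunit_minus nonunit_add nonunit_sum term_nonunit nonunit_mult pR y)
  ultimately show False using not_nonunit_emb[of a] J(2) cJ by simp
qed

end

section \<open>Uniformizers and the induced valuation\<close>

locale function_field_valuation_ring =
  curve emb + valuation_ring emb R for emb :: "'k::{finite,field} \<Rightarrow> 'f::field" and R
begin

text \<open>Discreteness in finite form: strict divisibility chains of nonunits dividing
  \<open>y\<close> are independent over \<open>k[y]\<close>, so the finite degree bounds their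
  length.\<close>

lemma chain_bounded:
  assumes y: "nonunit y" "y \<noteq> 0"
  shows "\<exists>K. \<forall>n z. (\<forall>i<n. z i \<noteq> 0 \<and> nonunit (z i) \<and> y / z i \<in> R) \<longrightarrow>
    (\<forall>i j. i < j \<longrightarrow> j < n \<longrightarrow> nonunit (z i / z j)) \<longrightarrow> n \<le> (K::nat)"
proof -
  obtain K where "\<And>n z. indep_over y {..<n::nat} z \<Longrightarrow> n \<le> K"
    using indep_over_bounded by blast
  with chain_indep[OF y] show ?thesis by blast
qed

text \<open>Otherwise every nonzero nonunit \<open>t\<close> fails to divide some nonunit
  \<open>z\<close>, and then \<open>z\<close> divides \<open>t\<close> strictly. Starting from
  \<open>y\<close> this builds arbitrarily long chains of divisors of \<open>y\<close>.\<close>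

lemma uniformizer_exists:
  assumes y: "nonunit y" "y \<noteq> 0"
  shows "\<exists>t. t \<noteq> 0 \<and> nonunit t \<and> (\<forall>z. nonunit z \<longrightarrow> z / t \<in> R)"
proof (rule ccontr)
  assume contra: "\<not> ?thesis"
  have ex: "\<exists>z. nonunit z \<and> z / t \<notin> R" if "t \<noteq> 0" "nonunit t" for t
    using contra that by blast
  let ?P = "\<lambda>t. t \<noteq> 0 \<and> nonunit t \<and> y / t \<in> R"
  have "\<exists>f. \<forall>n. ?P (f n) \<and> nonunit (f n / f (Suc n))"
  proof (rule dependent_nat_choice)
    show "\<exists>t. ?P t" using y subalgebra_1[OF R] by (intro exI[of _ y]) auto
    fix t n assume t: "?P t"
    with ex obtain z where z: "nonunit z" "z / t \<notin> R" by blast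
    then have z0: "z \<noteq> 0" using subalgebra_0[OF R] by auto
    have tz: "nonunit (t / z)" using z t by (simp add: nonunit_def inverse_eq_divide)
    have "y / z = (y / t) * (t / z)" using t by simp
    then have "y / z \<in> R" using t tz nonunit_in subalgebra_mult[OF R] by metis
    with z z0 tz show "\<exists>z. ?P z \<and> nonunit (t / z)" by blast
  qed
  then obtain f where f: "\<And>n. ?P (f n)" "\<And>n. nonunit (f n / f (Suc n))" by blast
  have less: "nonunit (f i / f j)" if "i < j" for i j
    using that
  proof (induction j rule: nat_induct)
    case (Suc j)
    show ?case
    proof (cases "i = j")
      case False
      with Suc have "nonunit (f i / f j)" by simp
      from nonunit_mult[OF nonunit_in[OF this] f(2)[of j]] show ?thesis
        using f(1)[of j] by simp
    qed (use f in auto)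
  qed simp
  obtain K where K: "\<forall>n z. (\<forall>i<n. z i \<noteq> 0 \<and> nonunit (z i) \<and> y / z i \<in> R) \<longrightarrow>
    (\<forall>i j. i < j \<longrightarrow> j < n \<longrightarrow> nonunit (z i / z j)) \<longrightarrow> n \<le> (K::nat)"
    using chain_bounded[OF y] by blast
  then have "Suc K \<le> K" using f(1) less by blast
  then show False by simp
qed

definition unit :: "'f \<Rightarrow> bool" where
  "unit z \<longleftrightarrow> z \<noteq> 0 \<and> z \<in> R \<and> inverse z \<in> R"

lemma unit_iff: "unit z \<longleftrightarrow> z \<in> R \<and> \<not> nonunit z"
  by (auto simp: unit_def nonunit_def)

lemma unit_mult: "unit a \<Longrightarrow> unit b \<Longrightarrow> unit (a * b)"
  and unit_inverse: "unit a \<Longrightarrow> unit (inverse a)"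
  using subalgebra_mult[OF R] by (auto simp: unit_def)

context
  fixes t assumes t: "t \<noteq> 0" "nonunit t" and gen: "\<And>z. nonunit z \<Longrightarrow> z / t \<in> R"
begin

lemma nonunit_power: "n > 0 \<Longrightarrow> nonunit (t ^ n)"
  using nonunit_mult[OF subalgebra_power[OF R nonunit_in[OF t(2)]] t(2)]
  by (cases n) (auto simp: mult.commute)

text \<open>Divide by \<open>t\<close> while the quotient stays in \<open>R\<close>. This stops
  because the powers of \<open>t\<close> dividing \<open>z\<close> form a chain, and the last
  quotient is a unit since a nonunit could be divided once more.\<close>

lemma unit_times_power_nat:
  assumes "z \<in> R" "z \<noteq> 0"
  obtains n u where "unit u" "z = u * t ^ n"
proof (cases "nonunit z")
  case True
  have "\<exists>n. z / t ^ n \<notin> R"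
  proof (rule ccontr)
    assume "\<not> (\<exists>n. z / t ^ n \<notin> R)"
    then have all: "\<And>n. z / t ^ n \<in> R" by blast
    obtain K where K: "\<forall>n x. (\<forall>i<n. x i \<noteq> 0 \<and> nonunit (x i) \<and> z / x i \<in> R) \<longrightarrow>
      (\<forall>i j. i < j \<longrightarrow> j < n \<longrightarrow> nonunit (x i / x j)) \<longrightarrow> n \<le> (K::nat)"
      using chain_bounded[OF True assms(2)] by blast
    \<comment> \<open>The exponents \<open>Suc K - i\<close> fall from \<open>Suc K\<close> to
      \<open>1\<close>: the direction that \<open>chain_bounded\<close> expects, and always positive
      so that each power is a nonunit.\<close>
    have "nonunit (t ^ (Suc K - i) / t ^ (Suc K - j))" if "i < j" "j < Suc K" for i j
    proof -
      have "t ^ (Suc K - i) = t ^ (j - i) * t ^ (Suc K - j)"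
        using that by (simp flip: power_add)
      then show ?thesis using that t nonunit_power[of "j - i"] by simp
    qed
    then have "Suc K \<le> K"
      using K[rule_format, of "Suc K" "\<lambda>i. t ^ (Suc K - i)"] all t nonunit_power by auto
    then show False by simp
  qed
  define n where "n = (LEAST n. z / t ^ n \<notin> R)"
  have n: "z / t ^ n \<notin> R" unfolding n_def using \<open>\<exists>n. _\<close> by (rule LeastI_ex)
  then obtain m where m: "n = Suc m" using assms by (cases n) auto
  have "z / t ^ m \<in> R"
    using not_less_Least[of m "\<lambda>n. z / t ^ n \<notin> R"] m n_def by auto
  moreover have "\<not> nonunit (z / t ^ m)" using gen[of "z / t ^ m"] n m by (auto simp: mult.commute)
  ultimately have "unit (z / t ^ m)" by (simp add: unit_iff)
  moreover have "z = (z / t ^ m) * t ^ m" using t by simp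
  ultimately show ?thesis using that by blast
next
  case False
  then show ?thesis using assms that[of z 0] by (simp add: unit_iff)
qed

lemma unit_times_power:
  assumes "z \<noteq> 0"
  obtains n u where "unit u" "z = u * t powi n"
proof (cases "z \<in> R")
  case True
  from unit_times_power_nat[OF True assms] obtain n u where "unit u" "z = u * t ^ n" .
  then show ?thesis using that[of u "int n"] by simp
next
  case False
  then have "inverse z \<in> R" using val by blast
  from unit_times_power_nat[OF this] assms obtain n u where u: "unit u" "inverse z = u * t ^ n"
    by (metis inverse_nonzero_iff_nonzero)
  then have "z = inverse u * t powi (- int n)"
    by (metis inverse_inverse_eq inverse_mult_distrib power_int_minus power_int_of_nat)
  then show ?thesis using that unit_inverse[OF u(1)] by blast
qed

definition pval :: "'f \<Rightarrow> int" where
  "pval z = (if z = 0 then 0 else THE n. \<exists>u. unit u \<and> z = u * t powi n)"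

lemma unit_powi: "unit (t powi n) \<longleftrightarrow> n = 0"
proof -
  have pos: "\<not> unit (t powi n)" if "n > 0" for n
    using nonunit_power[of "nat n"] that by (auto simp: unit_iff power_int_def)
  show ?thesis
    using pos[of n] pos[of "- n"] unit_inverse[of "t powi n"] subalgebra_1[OF R]
    by (cases n "0::int" rule: linorder_cases) (auto simp: power_int_minus unit_def)
qed

lemma pval_eqI:
  assumes "unit u" "z = u * t powi n"
  shows "pval z = n"
proof -
  have "m = n" if "unit w" "z = w * t powi m" for w m
  proof -
    have "u * t powi n = w * t powi m" using assms that by simp
    then have "t powi (n - m) = w * inverse u"
      using t assms(1) that(1) by (simp add: power_int_diff unit_def field_simps)
    then show ?thesis using unit_powi[of "n - m"] unit_mult[OF that(1) unit_inverse[OF assms(1)]] by simp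
  qed
  moreover have "z \<noteq> 0" using assms t by (auto simp: unit_def)
  ultimately show ?thesis unfolding pval_def using assms by auto
qed

lemma pval_nonneg_iff: "z \<noteq> 0 \<Longrightarrow> pval z \<ge> 0 \<longleftrightarrow> z \<in> R"
proof -
  assume z: "z \<noteq> 0"
  have *: "z \<in> R" if "pval z \<ge> 0" "z \<noteq> 0" for z
  proof -
    from unit_times_power[OF that(2)] obtain n u where u: "unit u" "z = u * t powi n" .
    then have "n \<ge> 0" using that pval_eqI by auto
    then have "t powi n \<in> R"
      using subalgebra_power[OF R nonunit_in[OF t(2)]] by (simp add: power_int_def)
    then show ?thesis using u subalgebra_mult[OF R] by (simp add: unit_def)
  qed
  have "pval z \<ge> 0" if "z \<in> R"
  proof -
    from unit_times_power_nat[OF that z] obtain n u where "unit u" "z = u * t ^ n" .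
    then have "pval z = int n" by (intro pval_eqI) auto
    then show ?thesis by simp
  qed
  with * z show ?thesis by blast
qed

lemma pval_mult: "x \<noteq> 0 \<Longrightarrow> y \<noteq> 0 \<Longrightarrow> pval (x * y) = pval x + pval y"
proof -
  assume "x \<noteq> 0" "y \<noteq> 0"
  then obtain n u m w where u: "unit u" "x = u * t powi n" and w: "unit w" "y = w * t powi m"
    using unit_times_power by metis
  have "pval (x * y) = n + m"
    using u w t by (intro pval_eqI[of "u * w"] unit_mult) (auto simp: power_int_add)
  then show ?thesis using u w pval_eqI by metis
qed

lemma place_pval: "place emb pval"
  unfolding place_def
proof (intro conjI allI impI)
  show "pval 0 = 0" by (simp add: pval_def)
  show "pval (x * y) = pval x + pval y" if "x \<noteq> 0" "y \<noteq> 0" for x y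
    using pval_mult that .
  show "pval (emb c) = 0" if "c \<noteq> 0" for c
    using that subalgebra_emb[OF R]
    by (intro pval_eqI[of "emb c"]) (auto simp: unit_def emb_inverse)
  show "\<exists>t. pval t = 1"
    using subalgebra_1[OF R] by (intro exI[of _ t] pval_eqI[of 1]) (auto simp: unit_def)
  \<comment> \<open>\<open>x + y = x * (1 + y / x)\<close>, and the second factor lies in
    \<open>R\<close> once the order of \<open>x\<close> is at most that of \<open>y\<close>.\<close>
  have *: "pval (x + y) \<ge> pval x" if "x \<noteq> 0" "y \<noteq> 0" "x + y \<noteq> 0" "pval x \<le> pval y" for x y
  proof -
    have yx: "y = x * (y / x)" using that by simp
    then have "pval y = pval x + pval (y / x)" using that pval_mult[of x "y / x"] by simp
    then have "y / x \<in> R" using that pval_nonneg_iff[of "y / x"] by simp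
    then have "1 + y / x \<in> R" using subalgebra_add[OF R subalgebra_1[OF R]] by blast
    moreover have e: "x + y = x * (1 + y / x)" using that by (simp add: field_simps)
    moreover have nz: "1 + y / x \<noteq> 0" using that e by auto
    ultimately have "pval (1 + y / x) \<ge> 0" using pval_nonneg_iff by blast
    then show ?thesis using pval_mult[OF that(1) nz] e by simp
  qed
  show "pval (x + y) \<ge> min (pval x) (pval y)" if "x \<noteq> 0" "y \<noteq> 0" "x + y \<noteq> 0" for x y
    using *[of x y] *[of y x] that by (auto simp: add.commute min_def)
qed

end

end

section \<open>Chevalley's descent on two opposite relations\<close>

context curve
begin

text \<open>As \<open>1 - y b\<^sub>0\<close> is invertible, the relation for \<open>inverse z\<close> expresses \<open>z\<^sup>n\<close> through lower powers of \<open>z\<close>.\<close>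

lemma lower_degree:
  assumes R: "subalgebra R" and y: "y \<in> R" "y \<noteq> 0" "z \<noteq> 0"
    and unit: "\<And>a. a \<in> R \<Longrightarrow> 1 - y * a \<noteq> 0 \<and> inverse (1 - y * a) \<in> R"
    and a: "\<And>i. a i \<in> R" "inverse y = (\<Sum>i\<le>n. a i * z ^ i)"
    and b: "\<And>j. b j \<in> R" "inverse y = (\<Sum>j\<le>m. b j * inverse z ^ j)"
    and mn: "m \<le> n" "0 < n"
  shows "\<exists>a'. (\<forall>i. a' i \<in> R) \<and> inverse y = (\<Sum>i\<le>n-1. a' i * z ^ i)"
proof -
  define s where "s = inverse (1 - y * b 0)"
  have s: "s \<in> R" "1 - y * b 0 \<noteq> 0" using unit[OF b(1)[of 0]] by (auto simp: s_def)
  define c where "c = a n * y * s"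
  have c: "c \<in> R" unfolding c_def by (intro subalgebra_mult[OF R] a y s)
  have "(\<Sum>j\<le>m. b j * inverse z ^ j) = b 0 + (\<Sum>j=1..m. b j * inverse z ^ j)"
    by (simp add: atMost_atLeast0 sum.atLeast_Suc_atMost)
  then have "1 - y * b 0 = y * (\<Sum>j=1..m. b j * inverse z ^ j)"
    using b(2) y(2) by (simp add: field_simps)
  moreover have "s * (1 - y * b 0) = 1" using s(2) by (simp add: s_def)
  ultimately have one: "s * (y * (\<Sum>j=1..m. b j * inverse z ^ j)) = 1" by metis
  have "a n * z ^ n = a n * z ^ n * (s * (y * (\<Sum>j=1..m. b j * inverse z ^ j)))"
    unfolding one by simp
  also have "\<dots> = c * ((\<Sum>j=1..m. b j * inverse z ^ j) * z ^ n)"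
    unfolding c_def by (simp only: mult_ac)
  also have "(\<Sum>j=1..m. b j * inverse z ^ j) * z ^ n = (\<Sum>j=1..m. b j * (inverse z ^ j * z ^ n))"
    by (simp only: sum_distrib_right mult.assoc)
  also have "(\<Sum>j=1..m. b j * (inverse z ^ j * z ^ n)) = (\<Sum>j=1..m. b j * z ^ (n - j))"
  proof (rule sum.cong)
    fix j assume "j \<in> {1..m}"
    then have "z ^ n = z ^ j * z ^ (n - j)" using mn by (simp flip: power_add)
    then show "b j * (inverse z ^ j * z ^ n) = b j * z ^ (n - j)"
      using y(3) by (simp add: field_simps)
  qed simp
  also have "\<dots> = (\<Sum>i\<in>{n-m..n-1}. b (n - i) * z ^ i)"
    by (rule sum.reindex_bij_witness[of _ "\<lambda>i. n - i" "\<lambda>j. n - j"]) (use mn in auto)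
  also have "\<dots> = (\<Sum>i\<le>n-1. (if n - m \<le> i then b (n - i) else 0) * z ^ i)"
    by (rule sum.mono_neutral_cong_left) auto
  finally have an: "a n * z ^ n = (\<Sum>i\<le>n-1. c * (if n - m \<le> i then b (n - i) else 0) * z ^ i)"
    by (simp add: sum_distrib_left mult.assoc)
  have "inverse y = (\<Sum>i\<le>n-1. a i * z ^ i) + a n * z ^ n"
    using a(2) mn by (cases n) auto
  also have "\<dots> = (\<Sum>i\<le>n-1. (a i + c * (if n - m \<le> i then b (n - i) else 0)) * z ^ i)"
    by (simp add: an sum.distrib ring_distribs)
  finally show ?thesis
    using a(1) b(1) c subalgebra_add[OF R] subalgebra_mult[OF R] subalgebra_0[OF R]
    by (intro exI[of _ "\<lambda>i. a i + c * (if n - m \<le> i then b (n - i) else 0)"]) auto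
qed

text \<open>The longer relation is shortened with the help of the other, \<open>z\<close> and
  \<open>inverse z\<close> exchanging roles when needed. A relation of degree \<open>0\<close> would
  put \<open>inverse y\<close> into \<open>R\<close>.\<close>

lemma no_relations:
  assumes R: "subalgebra R" and y: "y \<in> R" "y \<noteq> 0" "inverse y \<notin> R"
    and unit: "\<And>a. a \<in> R \<Longrightarrow> 1 - y * a \<noteq> 0 \<and> inverse (1 - y * a) \<in> R"
  shows "z \<noteq> 0 \<Longrightarrow> (\<forall>i. a i \<in> R) \<Longrightarrow> inverse y = (\<Sum>i\<le>n. a i * z ^ i) \<Longrightarrow>
    (\<forall>j. b j \<in> R) \<Longrightarrow> inverse y = (\<Sum>j\<le>m. b j * inverse z ^ j) \<Longrightarrow> False"
proof (induction "n + m" arbitrary: n m z a b rule: less_induct)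
  case less
  note low = lower_degree[OF R y(1,2) _ unit]
  consider "n = 0" | "m = 0" | "m \<le> n" "n > 0" | "n \<le> m" "m > 0" by linarith
  then show ?case
  proof cases
    case 1
    then have "inverse y = a 0" using less.prems(3) by simp
    then show False using less.prems(2) y(3) by metis
  next
    case 2
    then have "inverse y = b 0" using less.prems(5) by simp
    then show False using less.prems(4) y(3) by metis
  next
    case 3
    obtain a' where "\<forall>i. a' i \<in> R" "inverse y = (\<Sum>i\<le>n-1. a' i * z ^ i)"
      using low[OF less.prems(1) _ less.prems(2)[rule_format] less.prems(3) less.prems(4)[rule_format] less.prems(5) 3] by auto
    then show False using less.hyps[of "n - 1" m z a' b] less.prems 3 by simp
  next
    case 4
    obtain b' where "\<forall>i. b' i \<in> R" "inverse y = (\<Sum>i\<le>m-1. b' i * inverse z ^ i)"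
      using low[of "inverse z" b m a n] less.prems 4 by auto
    then show False using less.hyps[of n "m - 1" z a b'] less.prems 4 by simp
  qed
qed

end

section \<open>Existence of poles and Riemann-Roch spaces\<close>

context curve
begin

lemma transc_neq_0: "transc emb x \<Longrightarrow> x \<noteq> 0"
  using transc_peval[of x] by (auto dest: spec[of _ "[:0, 1:]"])

lemma not_transc_emb: "\<not> transc emb (emb c)"
  using transc_peval[of "emb c"] by (auto simp: emb_minus dest: spec[of _ "[:- c, 1:]"])

lemma transc_inverse:
  assumes "transc emb x"
  shows "transc emb (inverse x)"
proof (rule algebraic_or_transc[of "inverse x"])
  fix c assume "inverse x = emb c"
  then have "x = emb (inverse c)" by (metis emb_inverse inverse_inverse_eq)
  then show ?thesis using assms not_transc_emb by simp
qed

text \<open>Zorn's lemma starts from \<open>k[inverse x]\<close>. It misses \<open>x\<close>: from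
  \<open>x = p(inverse x)\<close> the polynomial \<open>pCons 0 p - 1\<close>, with constant term
  \<open>-1\<close>, would vanish at \<open>inverse x\<close>.\<close>

lemma maximal_subalgebra_exists:
  assumes x: "transc emb x"
  shows "\<exists>R. subalgebra R \<and> inverse x \<in> R \<and> x \<notin> R \<and>
    (\<forall>R'. subalgebra R' \<longrightarrow> R \<subseteq> R' \<longrightarrow> x \<notin> R' \<longrightarrow> R' = R)"
proof -
  let ?y = "inverse x"
  let ?A = "{R. subalgebra R \<and> ?y \<in> R \<and> x \<notin> R}"
  have x0: "x \<noteq> 0" using x by (rule transc_neq_0)
  let ?R0 = "range (\<lambda>p. peval p ?y)"
  have "emb c \<in> ?R0" for c by (rule range_eqI[of _ _ "[:c:]"]) simp
  then have "subalgebra ?R0"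
    unfolding subalgebra_def by (auto simp flip: peval_add peval_mult)
  moreover have "?y \<in> ?R0" by (rule range_eqI[of _ _ "[:0, 1:]"]) simp
  moreover have "x \<notin> ?R0"
  proof
    assume "x \<in> ?R0"
    then obtain p where "x = peval p ?y" by blast
    then have "peval (pCons 0 p - 1) ?y = 0" using x0 by (simp add: peval_diff)
    moreover have "coeff (pCons 0 p - 1) 0 \<noteq> 0" by simp
    then have "pCons 0 p - 1 \<noteq> 0" by (metis coeff_0)
    ultimately show False using transc_inverse[OF x] transc_peval by blast
  qed
  ultimately have "?A \<noteq> {}" by blast
  moreover have "\<Union>C \<in> ?A" if C: "C \<noteq> {}" "subset.chain ?A C" for C
  proof -
    have sub: "R \<in> ?A" if "R \<in> C" for R using that C by (auto simp: subset_chain_def)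
    have "\<exists>R\<in>C. a \<in> R \<and> b \<in> R" if "a \<in> \<Union>C" "b \<in> \<Union>C" for a b
      using that C(2) unfolding subset_chain_def by blast
    then have "a + b \<in> \<Union>C \<and> a * b \<in> \<Union>C" if "a \<in> \<Union>C" "b \<in> \<Union>C" for a b
      using that sub unfolding subalgebra_def by blast
    moreover have "range emb \<subseteq> \<Union>C" using C(1) sub subalgebra_emb by blast
    ultimately have "subalgebra (\<Union>C)" unfolding subalgebra_def by blast
    then show ?thesis using C(1) sub by blast
  qed
  ultimately obtain R where "R \<in> ?A" "\<forall>X\<in>?A. R \<subseteq> X \<longrightarrow> X = R"
    using subset_Zorn_nonempty[of ?A] by blast
  then show ?thesis by (intro exI[of _ R]) blast
qed

text \<open>A subalgebra maximal among those with \<open>inverse x\<close> but without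
  \<open>x\<close> is a valuation ring: adjoining any further element produces \<open>x\<close>, and
  such expressions for both \<open>z\<close> and \<open>inverse z\<close> contradict
  \<open>no_relations\<close>. The resulting order is negative at \<open>x\<close>, which lies
  outside the ring.\<close>

lemma pole_exists:
  assumes x: "transc emb x"
  shows "\<exists>v. place emb v \<and> v x < 0"
proof -
  define y where "y = inverse x"
  obtain R where R: "subalgebra R" and yR: "y \<in> R" and xR: "x \<notin> R"
    and max: "\<And>R'. subalgebra R' \<Longrightarrow> R \<subseteq> R' \<Longrightarrow> x \<notin> R' \<Longrightarrow> R' = R"
    unfolding y_def using maximal_subalgebra_exists[OF x] by blast
  have x0: "x \<noteq> 0" and y0: "y \<noteq> 0" and xy: "inverse y = x"
    using transc_neq_0[OF x] by (auto simp: y_def)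
  have unit: "1 - y * a \<noteq> 0 \<and> inverse (1 - y * a) \<in> R" if a: "a \<in> R" for a
  proof -
    define e where "e = 1 - y * a"
    have eR: "e \<in> R"
      unfolding e_def by (intro subalgebra_diff subalgebra_1 subalgebra_mult R yR a)
    have e0: "e \<noteq> 0"
    proof
      assume "e = 0"
      then have "a = x" using x0 by (simp add: e_def y_def field_simps)
      with a xR show False by simp
    qed
    \<comment> \<open>The localization of \<open>R\<close> at \<open>e\<close>. It still misses
      \<open>x\<close>, so maximality gives \<open>R' = R\<close> and \<open>e\<close> is a unit of
      \<open>R\<close>.\<close>
    define R' where "R' = {r / e ^ n | r n. r \<in> R}"
    have R'I: "z \<in> R'" if "z * e ^ n \<in> R" for z n
      using that e0 unfolding R'_def by (auto intro!: exI[of _ "z * e ^ n"] exI[of _ n])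
    have RR': "R \<subseteq> R'" using R'I[of _ 0] by auto
    have "r / e ^ n + r' / e ^ n' \<in> R' \<and> r / e ^ n * (r' / e ^ n') \<in> R'"
      if r: "r \<in> R" "r' \<in> R" for r r' n n'
    proof
      have "(r / e ^ n + r' / e ^ n') * e ^ (n + n') = r * e ^ n' + r' * e ^ n"
        using e0 by (simp add: field_simps power_add)
      also have "\<dots> \<in> R" by (intro subalgebra_add subalgebra_mult subalgebra_power R r eR)
      finally show "r / e ^ n + r' / e ^ n' \<in> R'" by (rule R'I)
      have "r / e ^ n * (r' / e ^ n') * e ^ (n + n') = r * r'"
        using e0 by (simp add: field_simps power_add)
      also have "\<dots> \<in> R" by (intro subalgebra_mult R r)
      finally show "r / e ^ n * (r' / e ^ n') \<in> R'" by (rule R'I)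
    qed
    moreover have "range emb \<subseteq> R'" using RR' subalgebra_emb[OF R] by blast
    ultimately have "subalgebra R'" unfolding subalgebra_def R'_def by blast
    moreover have "x \<notin> R'"
    proof
      assume "x \<in> R'"
      then obtain r n where "x = r / e ^ n" "r \<in> R" unfolding R'_def by blast
      then have "x * e ^ n \<in> R" using e0 by simp
      then show False
      proof (induction n)
        case 0
        then show False using xR by simp
      next
        case (Suc n)
        \<comment> \<open>Since \<open>x * e = x - a\<close>, one factor \<open>e\<close> after
          another can be removed, until \<open>x\<close> itself would lie in
          \<open>R\<close>.\<close>
        have "x * e ^ n = x * e ^ Suc n + a * e ^ n"
          using x0 by (simp add: e_def y_def algebra_simps)
        also have "\<dots> \<in> R"
          by (rule subalgebra_add[OF R Suc.prems subalgebra_mult[OF R a subalgebra_power[OF R eR]]])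
        finally show False using Suc.IH by blast
      qed
    qed
    ultimately have "R' = R" using max RR' by blast
    moreover have "inverse e \<in> R'" using R'I[of "inverse e" 1] e0 subalgebra_1[OF R] by simp
    ultimately show ?thesis using e0 by (simp add: e_def)
  qed
  have adjoin: "\<exists>a n. (\<forall>i. a i \<in> R) \<and> x = (\<Sum>i\<le>n. a i * z ^ i)" if z: "z \<notin> R" for z
  proof -
    define R' where "R' = {poly p z | p. \<forall>i. coeff p i \<in> R}"
    have R'I: "poly p z \<in> R'" if "\<And>i. coeff p i \<in> R" for p
      using that unfolding R'_def by blast
    have const: "r \<in> R'" if "r \<in> R" for r
      using that R'I[of "[:r:]"] subalgebra_0[OF R] by (simp add: coeff_pCons split: nat.splits)
    have "poly p z + poly r z \<in> R' \<and> poly p z * poly r z \<in> R'"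
      if "\<forall>i. coeff p i \<in> R" "\<forall>i. coeff r i \<in> R" for p r
      using R'I[of "p + r"] R'I[of "p * r"] that
      by (simp add: coeff_mult subalgebra_add[OF R] subalgebra_mult[OF R] subalgebra_sum[OF R])
    moreover have "range emb \<subseteq> R'" using const subalgebra_emb[OF R] by blast
    ultimately have "subalgebra R'" unfolding subalgebra_def R'_def by blast
    moreover have "z \<in> R'"
      using R'I[of "[:0, 1:]"] subalgebra_0[OF R] subalgebra_1[OF R]
      by (simp add: coeff_pCons split: nat.splits)
    ultimately have "x \<in> R'" using max[of R'] const z by blast
    then obtain p where "\<forall>i. coeff p i \<in> R" "x = poly p z" unfolding R'_def by blast
    then show ?thesis
      by (intro exI[of _ "coeff p"] exI[of _ "degree p"]) (simp add: poly_altdef)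
  qed
  have val: "z \<in> R \<or> inverse z \<in> R" for z
  proof (rule ccontr)
    assume contra: "\<not> (z \<in> R \<or> inverse z \<in> R)"
    then have "z \<noteq> 0" using subalgebra_0[OF R] by auto
    moreover obtain a n where "\<forall>i. a i \<in> R" "inverse y = (\<Sum>i\<le>n. a i * z ^ i)"
      using adjoin[of z] contra xy by auto
    moreover obtain b m where "\<forall>i. b i \<in> R" "inverse y = (\<Sum>i\<le>m. b i * inverse z ^ i)"
      using adjoin[of "inverse z"] contra xy by auto
    ultimately show False using no_relations[OF R yR y0 _ unit] xR xy by blast
  qed
  interpret function_field_valuation_ring emb R
    by unfold_locales (use R val in auto)
  have "nonunit y" using xR xy by (simp add: nonunit_def)
  from uniformizer_exists[OF this y0] obtain t where
    t: "t \<noteq> 0" "nonunit t" "\<And>z. nonunit z \<Longrightarrow> z / t \<in> R" by blast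
  have "pval t x < 0" using pval_nonneg_iff[OF t x0] xR by auto
  with place_pval[OF t] show ?thesis by blast
qed

section \<open>Riemann-Roch spaces of rational divisors\<close>

lemma LL_iff: "y \<in> LL emb E \<longleftrightarrow> (\<forall>P. place emb P \<longrightarrow> vge P (- E P) y)"
proof -
  have "\<exists>P. place emb P"
  proof -
    obtain x where "transc emb x" using ff unfolding function_field_def by (elim conjE exE)
    then show ?thesis using pole_exists by blast
  qed
  then show ?thesis by (auto simp: LL_def vge_def)
qed

lemma LL_add: "y \<in> LL emb E \<Longrightarrow> z \<in> LL emb E \<Longrightarrow> y + z \<in> LL emb E"
  by (simp add: LL_iff vge_add)

lemma LL_diff: "y \<in> LL emb E \<Longrightarrow> z \<in> LL emb E \<Longrightarrow> y - z \<in> LL emb E"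
  by (simp add: LL_iff vge_diff)

lemma LL_emb_mult: "y \<in> LL emb E \<Longrightarrow> emb c * y \<in> LL emb E"
  using vge_mult[OF _ vge_emb] by (fastforce simp: LL_iff)

lemma LL_mono: "(\<And>P. place emb P \<Longrightarrow> E P \<le> E' P) \<Longrightarrow> LL emb E \<subseteq> LL emb E'"
  using vge_mono by (fastforce simp: LL_iff)

text \<open>A nonconstant function is transcendental and therefore has a pole.\<close>

lemma LL_zero: "LL emb (\<lambda>_. 0) = range emb"
proof
  show "range emb \<subseteq> LL emb (\<lambda>_. 0)" by (auto simp: LL_iff vge_emb)
  show "LL emb (\<lambda>_. 0) \<subseteq> range emb"
  proof
    fix y assume y: "y \<in> LL emb (\<lambda>_. 0)"
    show "y \<in> range emb"
    proof (rule algebraic_or_transc[of y])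
      assume t: "transc emb y"
      then obtain v where "place emb v" "v y < 0" using pole_exists by blast
      then show ?thesis using y transc_neq_0[OF t] by (auto simp: LL_def)
    qed auto
  qed
qed

text \<open>Allowing one more pole order at a rational point adds at most one dimension: functions
  with the same coefficient in the new order at \<open>P\<close> differ by an element of
  \<open>LL emb E\<close>.\<close>

lemma card_LL_step:
  assumes P: "rational_place emb P" and fin: "finite (LL emb E)"
  shows "finite (LL emb (E(P := E P + 1)))"
    "card (LL emb (E(P := E P + 1))) \<le> CARD('k) * card (LL emb E)"
proof -
  have p: "place emb P" using P by (simp add: rational_place_def)
  then obtain t where t: "P t = 1" unfolding place_def by blast
  then have t0: "t \<noteq> 0" using place_0[OF p] by (metis zero_neq_one)
  \<comment> \<open>As \<open>s\<close> has order \<open>E P + 1\<close> at \<open>P\<close>, the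
    product \<open>y * s\<close> is regular there and its value is the coefficient of
    \<open>y\<close> in the new order.\<close>
  define s where "s = t powi (E P + 1)"
  have s0: "s \<noteq> 0" using t0 by (simp add: s_def)
  have Ps: "P s = E P + 1"
    unfolding s_def power_int_def using t
    by (simp add: place_power[OF p] place_inverse[OF p] flip: power_inverse)
  let ?X = "LL emb (E(P := E P + 1))"
  let ?h = "\<lambda>y. eval_at emb P (y * s)"
  have reg: "vge P 0 (y * s)" if "y \<in> ?X" for y
    using that vge_mult[OF p, of "- (E P + 1)" y "E P + 1" s] p Ps
    by (fastforce simp: LL_iff vge_def[of _ _ s])
  have "y - y' \<in> LL emb E" if "y \<in> ?X" "y' \<in> ?X" "?h y = ?h y'" for y y'
  proof -
    have "vge P 1 (y * s - y' * s)"
      using vge_diff[OF p eval_at[OF P reg[OF that(1)]] eval_at[OF P reg[OF that(2)]]] that(3) by simp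
    then have "vge P 1 ((y - y') * s)" by (simp add: algebra_simps)
    then have "vge P (- E P) (y - y')"
      using s0 Ps place_mult[OF p, of "y - y'" s] by (cases "y - y' = 0") (auto simp: vge_def)
    moreover have "vge Q (- E Q) (y - y')" if "place emb Q" "Q \<noteq> P" for Q
      using LL_diff[OF \<open>y \<in> ?X\<close> \<open>y' \<in> ?X\<close>] that by (auto simp: LL_iff dest: spec[of _ Q])
    ultimately show ?thesis unfolding LL_iff by blast
  qed
  then have fib: "\<And>y y'. y \<in> ?X \<Longrightarrow> y' \<in> ?X \<Longrightarrow> ?h y = ?h y' \<Longrightarrow> y - y' \<in> LL emb E" .
  show "finite ?X"
    by (rule card_le_fibres(1)[where Y = UNIV and h = ?h, OF _ fin _ fib]) simp_all
  show "card ?X \<le> CARD('k) * card (LL emb E)"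
    by (rule card_le_fibres(2)[where Y = UNIV and h = ?h, OF _ fin _ fib]) simp_all
qed

lemma card_LL_le:
  fixes a :: "('f \<Rightarrow> int) \<Rightarrow> nat"
  assumes S: "finite S" "\<And>P. P \<in> S \<Longrightarrow> rational_place emb P"
    and a: "\<And>P. P \<notin> S \<Longrightarrow> a P = 0"
  shows "finite (LL emb (\<lambda>P. int (a P))) \<and>
    card (LL emb (\<lambda>P. int (a P))) \<le> CARD('k) ^ (sum a S + 1)"
  using a
proof (induction "sum a S" arbitrary: a)
  case 0
  have "a P = 0" for P using 0 S(1) by (cases "P \<in> S") auto
  then have "LL emb (\<lambda>P. int (a P)) = range emb" by (simp add: LL_zero)
  then show ?case using card_image_le[of "UNIV :: 'k set" emb] by (simp flip: 0(1))
next
  case (Suc n)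
  have "\<exists>P\<in>S. a P \<noteq> 0"
  proof (rule ccontr)
    assume "\<not> ?thesis"
    then have "sum a S = 0" by simp
    with Suc(2) show False by simp
  qed
  then obtain P where P: "P \<in> S" "a P > 0" by blast
  define b where "b = a(P := a P - 1)"
  have ab_sum: "sum a S = Suc (sum b S)"
    using S(1) P by (simp add: b_def sum.remove[of S P])
  then have n: "n = sum b S" using Suc(2) by simp
  have ab: "(\<lambda>Q. int (a Q)) = (\<lambda>Q. int (b Q))(P := int (b P) + 1)"
    using P(2) by (auto simp: b_def)
  have b0: "b Q = 0" if "Q \<notin> S" for Q using Suc(3) P that by (auto simp: b_def)
  have IH: "finite (LL emb (\<lambda>P. int (b P)))"
    "card (LL emb (\<lambda>P. int (b P))) \<le> CARD('k) ^ (sum b S + 1)"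
    using Suc(1)[OF n b0] by auto
  from card_LL_step[OF S(2)[OF P(1)] IH(1)]
  have "finite (LL emb (\<lambda>P. int (a P)))"
    "card (LL emb (\<lambda>P. int (a P))) \<le> CARD('k) * card (LL emb (\<lambda>P. int (b P)))"
    unfolding ab by auto
  with mult_le_mono2[OF IH(2), of "CARD('k)"] show ?case
    unfolding ab_sum by (auto intro: order_trans)
qed

lemma finite_LL:
  assumes "rat_divisor emb E"
  shows "finite (LL emb E)"
proof -
  have E: "finite {P. E P \<noteq> 0}" "\<And>P. E P \<noteq> 0 \<Longrightarrow> rational_place emb P"
    using assms by (auto simp: rat_divisor_def is_divisor_def)
  have "finite (LL emb (\<lambda>P. int (nat (E P))))"
    using card_LL_le[of "{P. E P \<noteq> 0}" "\<lambda>P. nat (E P)"] E by auto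
  moreover have "LL emb E \<subseteq> LL emb (\<lambda>P. int (nat (E P)))"
    by (rule LL_mono) auto
  ultimately show ?thesis by (rule finite_subset[rotated])
qed

end

section \<open>Divisors of negative degree\<close>

context curve
begin

section \<open>Separation of places and weak approximation\<close>

lemma place_power_int: "place emb v \<Longrightarrow> v (x powi n) = n * v x"
  by (simp add: power_int_def place_power place_inverse flip: power_inverse)

text \<open>If \<open>v z = 0\<close> always forced \<open>w z = 0\<close>, then \<open>w\<close>
  would be an integer multiple of \<open>v\<close>, and as both take the value \<open>1\<close> the
  factor is \<open>1\<close> or \<open>-1\<close>. The factor \<open>-1\<close> fails at
  \<open>1 + t\<close>, where \<open>v\<close> is \<open>0\<close> and \<open>w\<close> is
  \<open>-1\<close>.\<close>

lemma distinct_places_separated: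
  assumes v: "place emb v" and w: "place emb w" and "v \<noteq> w"
  shows "\<exists>z. z \<noteq> 0 \<and> v z = 0 \<and> w z \<noteq> 0"
proof (rule ccontr)
  assume "\<not> ?thesis"
  then have sep: "\<And>z. z \<noteq> 0 \<Longrightarrow> v z = 0 \<Longrightarrow> w z = 0" by blast
  obtain t where t: "v t = 1" using v unfolding place_def by blast
  obtain s where s: "w s = 1" using w unfolding place_def by blast
  have t0: "t \<noteq> 0" using t place_0[OF v] by (metis zero_neq_one)
  have s0: "s \<noteq> 0" using s place_0[OF w] by (metis zero_neq_one)
  have multiple: "w z = w t * v z" if "z \<noteq> 0" for z
  proof -
    have nz: "t powi (- v z) \<noteq> 0" using t0 by simp
    have "w (z * t powi (- v z)) = 0"
      using that nz t by (intro sep) (auto simp: place_mult[OF v] place_power_int[OF v])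
    then show ?thesis
      using that nz by (simp add: place_mult[OF w] place_power_int[OF w] mult.commute)
  qed
  have "w t * v s = 1" using multiple[OF s0] s by simp
  then consider "w t = 1" | "w t = - 1" by (metis zmult_eq_1_iff)
  then show False
  proof cases
    case 1
    have "v z = w z" for z
      using multiple[of z] 1 place_0[OF v] place_0[OF w] by (cases "z = 0") auto
    with \<open>v \<noteq> w\<close> show False by blast
  next
    case 2
    have "1 + t \<noteq> 0" "v (1 + t) = 0"
      using place_add_eq[OF v, of 1 0 t] t place_1[OF v] by (auto simp: vge_def)
    moreover have "w (t + 1) = - 1"
      using place_add_eq[OF w 2 t0, of 1] place_1[OF w] by (auto simp: vge_def)
    ultimately show False using sep[of "1 + t"] by (simp add: add.commute)
  qed
qed

text \<open>The denominator takes the value \<open>1\<close> at every element of \<open>k\<close>, so it is a unit at each rational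
  place where \<^term>\<open>z\<close> is regular, and its pole order exceeds that of \<^term>\<open>z\<close> elsewhere.\<close>

definition regularize :: "'f \<Rightarrow> 'f" where
  "regularize z = z / (1 + (\<Prod>a\<in>UNIV. (z - emb a)))"

lemma regularize:
  assumes P: "rational_place emb P" and z: "z \<noteq> 0"
  shows "regularize z \<noteq> 0" "P (regularize z) \<ge> 0" "P (regularize z) = 0 \<longleftrightarrow> P z = 0"
proof -
  have p: "place emb P" using P by (simp add: rational_place_def)
  \<comment> \<open>With at least two constants, a pole of \<open>z\<close> turns into a genuine
    zero of \<open>regularize z\<close>, of order \<open>(CARD('k) - 1) * (- P z)\<close>.\<close>
  have q: "CARD('k) \<ge> 2" using card_constants by simp
  let ?g = "\<Prod>a\<in>UNIV. (z - emb a)"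
  have "1 + ?g \<noteq> 0 \<and> P (1 + ?g) = (if P z \<ge> 0 then 0 else int CARD('k) * P z)"
  proof (cases "P z \<ge> 0")
    case True
    then have reg: "vge P 0 z" by (simp add: vge_def)
    have "vge P 0 (\<Prod>a\<in>A. (z - emb a))" if "finite A" for A
      using that
    proof (induction A rule: finite_induct)
      case (insert a A)
      then show ?case using vge_mult[OF p vge_diff[OF p reg vge_emb[OF p]]] by fastforce
    qed (use vge_emb[OF p, of 1] in auto)
    then have "vge P 1 ((z - emb (eval_at emb P z)) * (\<Prod>a\<in>UNIV - {eval_at emb P z}. (z - emb a)))"
      using vge_mult[OF p eval_at[OF P reg], of 0] by simp
    then have "vge P 1 ?g" by (simp add: prod.remove[of UNIV "eval_at emb P z"])
    then show ?thesis using place_add_eq[OF p place_1[OF p]] True by auto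
  next
    case False
    have *: "z - emb a \<noteq> 0 \<and> P (z - emb a) = P z" for a
    proof -
      have "vge P (P z + 1) (- emb a)"
        by (rule vge_mono[OF vge_minus[OF p vge_emb[OF p]]]) (use False in simp)
      from place_add_eq[OF p refl z this] show ?thesis by simp
    qed
    have g0: "?g \<noteq> 0" using * by simp
    have Pg: "P ?g = int CARD('k) * P z" using place_prod[OF p, of UNIV "\<lambda>a. z - emb a"] * by simp
    moreover have "P ?g < 0" using False q by (simp add: Pg mult_pos_neg)
    ultimately show ?thesis
      using place_add_eq[OF p refl g0, of 1] place_1[OF p] False by (auto simp: vge_def add.commute)
  qed
  then have nz: "1 + ?g \<noteq> 0" and v: "P (1 + ?g) = (if P z \<ge> 0 then 0 else int CARD('k) * P z)"
    by auto
  show "regularize z \<noteq> 0" using nz z by (simp add: regularize_def)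
  have "P (regularize z) = P z - P (1 + ?g)"
    unfolding regularize_def using place_divide[OF p z nz] .
  also have "\<dots> = (if P z \<ge> 0 then P z else (1 - int CARD('k)) * P z)"
    unfolding v by (simp add: algebra_simps)
  finally have v': "P (regularize z) = (if P z \<ge> 0 then P z else (1 - int CARD('k)) * P z)" .
  show "P (regularize z) \<ge> 0" "P (regularize z) = 0 \<longleftrightarrow> P z = 0"
    unfolding v' using q by (auto simp: mult_nonpos_nonpos)
qed

text \<open>Each \<open>Q\<close> contributes a function that is a unit at \<open>P\<close> but not
  at \<open>Q\<close>. Once regularized, the factors are regular on all of \<open>T\<close>, so no
  pole of one cancels a zero of another in the product.\<close>

lemma weak_approximation:
  assumes T: "finite T" "\<And>Q. Q \<in> T \<Longrightarrow> rational_place emb Q" and P: "P \<in> T"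
  shows "\<exists>u. u \<noteq> 0 \<and> P u = 0 \<and> (\<forall>Q\<in>T - {P}. Q u \<ge> int N)"
proof -
  have pl: "place emb Q" if "Q \<in> T" for Q using T(2)[OF that] by (simp add: rational_place_def)
  have "\<exists>z. z \<noteq> 0 \<and> P z = 0 \<and> Q z \<noteq> 0" if "Q \<in> T - {P}" for Q
    using distinct_places_separated[of P Q] pl P that by auto
  then obtain z where z: "\<And>Q. Q \<in> T - {P} \<Longrightarrow> z Q \<noteq> 0 \<and> P (z Q) = 0 \<and> Q (z Q) \<noteq> 0" by metis
  define u where "u = (\<Prod>Q\<in>T - {P}. regularize (z Q) ^ N)"
  have nz: "regularize (z Q) \<noteq> 0" if "Q \<in> T - {P}" for Q
    using regularize(1)[OF T(2)[OF P]] z that by blast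
  have val: "R u = (\<Sum>Q\<in>T - {P}. int N * R (regularize (z Q)))" if "R \<in> T" for R
    unfolding u_def using nz
    by (subst place_prod[OF pl[OF that]]) (auto simp: place_power[OF pl[OF that]])
  have "u \<noteq> 0" using nz T(1) by (simp add: u_def)
  moreover have "P u = 0"
    unfolding val[OF P] using z regularize(3)[OF T(2)[OF P]] by (intro sum.neutral) auto
  moreover have "R u \<ge> int N" if R: "R \<in> T - {P}" for R
  proof -
    have RT: "R \<in> T" using R by blast
    have "R (regularize (z R)) \<ge> 1"
      using regularize(2,3)[OF T(2)[OF RT], of "z R"] z[OF R] by linarith
    then have "int N \<le> int N * R (regularize (z R))" by (simp add: mult_le_cancel_left1)
    also have "\<dots> \<le> R u"
      unfolding val[OF RT] using R T(1) regularize(2)[OF T(2)[OF RT]] z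
      by (intro member_le_sum) auto
    finally show ?thesis .
  qed
  ultimately show ?thesis by blast
qed

section \<open>Zeros, degree over \<open>k(x)\<close> and poles\<close>

lemma vge_peval_pole:
  assumes v: "place emb v" and x: "vge v (- int m) x" and p: "p \<in> polys_lt l"
  shows "vge v (- int (l * m)) (peval p x)"
  using p
proof (induction l arbitrary: p)
  case 0
  then show ?case by (simp add: polys_lt_0)
next
  case (Suc l)
  then obtain a p' where p': "p = pCons a p'" "p' \<in> polys_lt l" by (auto simp: polys_lt_Suc)
  have "vge v (- int (Suc l * m)) (emb a)" by (rule vge_mono[OF vge_emb[OF v]]) (simp only: neg_le_0_iff_le of_nat_0_le_iff)
  moreover have "vge v (- int (Suc l * m)) (x * peval p' x)"
    using vge_mult[OF v x Suc.IH[OF p'(2)]] by (simp add: algebra_simps)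
  ultimately show ?case unfolding p' by (simp add: vge_add[OF v])
qed

text \<open>The member of index \<open>(P, a)\<close> has order \<open>a\<close> at \<open>P\<close> and order at least that of \<^term>\<open>x\<close> at the
  other zeros, so constant terms of a relation vanish one order at a time.\<close>

lemma indep_at_zeros:
  fixes m :: "('f \<Rightarrow> int) \<Rightarrow> nat"
  assumes T: "finite T" "\<And>P. P \<in> T \<Longrightarrow> rational_place emb P"
    and x: "x \<noteq> 0" and m: "\<And>P. P \<in> T \<Longrightarrow> P x = int (m P)"
  shows "\<exists>w. indep_over x (SIGMA P:T. {..<m P}) w"
proof -
  have pl: "place emb Q" if "Q \<in> T" for Q using T(2)[OF that] by (simp add: rational_place_def)
  have "\<exists>w. w \<noteq> 0 \<and> P w = int a \<and> (\<forall>Q\<in>T - {P}. Q w \<ge> int (m Q))"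
    if P: "P \<in> T" for P and a :: nat
  proof -
    obtain t where t: "P t = 1" using pl[OF P] unfolding place_def by blast
    have t0: "t \<noteq> 0" using t place_0[OF pl[OF P]] by (metis zero_neq_one)
    \<comment> \<open>Large enough to outweigh the poles that \<open>t ^ a\<close> may have at the
      other points of \<open>T\<close> and still leave order \<open>m Q\<close>.\<close>
    define N where "N = (\<Sum>Q\<in>T. m Q + a * nat \<bar>Q t\<bar>)"
    obtain u where u: "u \<noteq> 0" "P u = 0" "\<And>Q. Q \<in> T - {P} \<Longrightarrow> Q u \<ge> int N"
      using weak_approximation[OF T P, of N] by blast
    have "Q (t ^ a * u) \<ge> int (m Q)" if Q: "Q \<in> T - {P}" for Q
    proof -
      have "m Q + a * nat \<bar>Q t\<bar> \<le> N"
        unfolding N_def using Q T(1) by (intro member_le_sum) auto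
      then have "int (m Q + a * nat \<bar>Q t\<bar>) \<le> Q u"
        using u(3)[OF Q] by linarith
      then have "int (m Q) + int a * \<bar>Q t\<bar> \<le> Q u" by simp
      moreover have "- (int a * \<bar>Q t\<bar>) \<le> int a * Q t"
        using mult_left_mono[of "- \<bar>Q t\<bar>" "Q t" "int a"] by simp
      moreover have "Q (t ^ a * u) = int a * Q t + Q u"
        using Q u t0 pl[of Q] by (simp add: place_mult place_power)
      ultimately show ?thesis by linarith
    qed
    moreover have "P (t ^ a * u) = int a"
      using u t t0 pl[OF P] by (simp add: place_mult place_power)
    ultimately show ?thesis using u t0 by (intro exI[of _ "t ^ a * u"]) auto
  qed
  then obtain w0 where w0: "\<And>P a. P \<in> T \<Longrightarrow>
      w0 P a \<noteq> 0 \<and> P (w0 P a) = int a \<and> (\<forall>Q\<in>T - {P}. Q (w0 P a) \<ge> int (m Q))"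
    by metis
  define w where "w j = w0 (fst j) (snd j)" for j
  let ?I = "SIGMA P:T. {..<m P}"
  have "indep_over x ?I w"
  proof (rule indep_overI[OF x], rule ccontr)
    fix c j0
    assume c: "(\<Sum>j\<in>?I. peval (c j) x * w j) = 0" and j0: "j0 \<in> ?I" "coeff (c j0) 0 \<noteq> 0"
    obtain P a0 where P: "P \<in> T" "a0 < m P" "coeff (c (P, a0)) 0 \<noteq> 0" using j0 by auto
    note p = pl[OF P(1)]
    \<comment> \<open>The minimum ranges over all natural numbers; comparison with \<open>a0\<close>
      keeps it below \<open>m P\<close>.\<close>
    define a where "a = (LEAST a. coeff (c (P, a)) 0 \<noteq> 0)"
    have ca: "coeff (c (P, a)) 0 \<noteq> 0" unfolding a_def using P(3) by (rule LeastI)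
    have am: "a < m P" using Least_le[of "\<lambda>a. coeff (c (P, a)) 0 \<noteq> 0", OF P(3)] P(2) a_def by simp
    have cmin: "coeff (c (P, b)) 0 = 0" if "b < a" for b
      using not_less_Least[of b "\<lambda>a. coeff (c (P, a)) 0 \<noteq> 0"] that a_def by auto
    have wP: "vge P 0 (w j)" if "j \<in> ?I" for j
      using that w0[of "fst j" "snd j"] P(1)
      by (cases "fst j = P") (auto simp: w_def vge_def intro: order_trans[of 0 "int (m P)"])
    define d where "d j = poly_shift 1 (c j)" for j
    have cd: "peval (c j) x = emb (coeff (c j) 0) + x * peval (d j) x" for j
    proof -
      have "c j = pCons (coeff (c j) 0) (d j)"
        by (rule poly_eqI) (auto simp: d_def coeff_pCons coeff_poly_shift split: nat.splits)
      then show ?thesis by (metis peval_pCons)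
    qed
    let ?c0 = "\<lambda>j. emb (coeff (c j) 0) * w j"
    have "(\<Sum>j\<in>?I. ?c0 j) + (\<Sum>j\<in>?I. x * peval (d j) x * w j) = 0"
      using c by (simp add: cd ring_distribs sum.distrib)
    moreover have "(\<Sum>j\<in>?I. ?c0 j) = ?c0 (P, a) + (\<Sum>j\<in>?I - {(P, a)}. ?c0 j)"
      using T(1) P am by (subst sum.remove[of _ "(P, a)"]) auto
    \<comment> \<open>The left side has order exactly \<open>a\<close> at \<open>P\<close>, while
      every term on the right will turn out to have order at least \<open>a + 1\<close>.\<close>
    ultimately have lead: "?c0 (P, a) =
        - ((\<Sum>j\<in>?I - {(P, a)}. ?c0 j) + (\<Sum>j\<in>?I. x * peval (d j) x * w j))"
      by (simp only: eq_neg_iff_add_eq_0 add.assoc)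
    have xP: "vge P 0 x" using m[OF P(1)] by (simp add: vge_def)
    have "vge P (int a + 1) (x * peval (d j) x * w j)" if "j \<in> ?I" for j
    proof -
      have "vge P (int a + 1) x" using m[OF P(1)] am by (simp add: vge_def)
      from vge_mult[OF p vge_mult[OF p this vge_peval[OF p xP]] wP[OF that]] show ?thesis by simp
    qed
    moreover have "vge P (int a + 1) (?c0 j)" if j: "j \<in> ?I - {(P, a)}" for j
    proof (cases "fst j = P \<and> snd j < a")
      case True
      then show ?thesis using cmin[of "snd j"] by (cases j) auto
    next
      case False
      then have "vge P (int a + 1) (w j)"
        using j w0[of "fst j" "snd j"] P(1) am by (cases "fst j = P") (force simp: w_def vge_def)+
      from vge_mult[OF p vge_emb[OF p] this] show ?thesis by simp
    qed
    ultimately have "vge P (int a + 1) (?c0 (P, a))"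
      unfolding lead by (intro vge_minus[OF p] vge_add[OF p] vge_sum[OF p])
    moreover have "?c0 (P, a) \<noteq> 0" "P (?c0 (P, a)) = int a"
      using w0[OF P(1), of a] ca by (auto simp: w_def place_mult[OF p] place_emb[OF p])
    ultimately show False by (simp add: vge_def)
  qed
  then show ?thesis by blast
qed

text \<open>The poles of \<^term>\<open>x\<close> count at least the degree over \<open>k(x)\<close>: multiples of the independent
  functions that are integral over \<open>k[x]\<close> have poles only over those of \<^term>\<open>x\<close>, and the
  combinations with coefficients of degree below \<open>l\<close> lie in a Riemann-Roch space of dimension
  \<open>l M + O(1)\<close>.\<close>

lemma card_indep_le_poles:
  fixes m :: "('f \<Rightarrow> int) \<Rightarrow> nat"
  assumes x: "transc emb x" and I: "finite I" and w: "indep_over x I w"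
    and S: "finite S" "\<And>P. P \<in> S \<Longrightarrow> rational_place emb P"
    and m: "\<And>P. P \<in> S \<Longrightarrow> P x = - int (m P)"
    and poles: "\<And>P. place emb P \<Longrightarrow> P \<notin> S \<Longrightarrow> P x \<ge> 0"
  shows "card I \<le> sum m S"
proof (rule ccontr)
  assume contra: "\<not> ?thesis"
  have "\<forall>j. \<exists>d. d \<noteq> 0 \<and> (\<forall>v. place emb v \<longrightarrow> vge v 0 x \<longrightarrow> vge v 0 (peval d x * w j))"
    using integral_multiple[OF x] by blast
  then obtain d where d: "\<And>j. d j \<noteq> 0"
      "\<And>j v. place emb v \<Longrightarrow> vge v 0 x \<Longrightarrow> vge v 0 (peval (d j) x * w j)" by metis
  define z where "z j = peval (d j) x * w j" for j
  have z: "indep_over x I z"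
    unfolding indep_over_def
  proof (intro allI impI)
    fix c assume "(\<Sum>j\<in>I. peval (c j) x * z j) = 0"
    then have "(\<Sum>j\<in>I. peval (c j * d j) x * w j) = 0"
      by (simp add: z_def peval_mult mult.assoc)
    then have "\<forall>j\<in>I. c j * d j = 0"
      using w[unfolded indep_over_def, rule_format, of "\<lambda>j. c j * d j"] by blast
    then show "\<forall>j\<in>I. c j = 0" using d(1) by (metis mult_eq_0_iff)
  qed
  \<comment> \<open>A bound for the pole orders of all \<open>z j\<close> at \<open>P\<close> that
    does not depend on \<open>l\<close>.\<close>
  define C where "C P = (\<Sum>j\<in>I. nat \<bar>P (z j)\<bar>)" for P :: "'f \<Rightarrow> int"
  have zC: "vge P (- int (C P)) (z j)" if "j \<in> I" for j P
  proof -
    have "nat \<bar>P (z j)\<bar> \<le> C P" unfolding C_def using that I by (intro member_le_sum) auto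
    then show ?thesis by (simp add: vge_def) linarith
  qed
  \<comment> \<open>If \<open>card I > sum m S\<close>, comparing exponents gives
    \<open>l \<le> sum C S + 1\<close>, one less than this choice.\<close>
  define l where "l = sum C S + 2"
  define A where "A P = (if P \<in> S then l * m P + C P else 0)" for P
  have fin: "finite (LL emb (\<lambda>P. int (A P)))"
    and card: "card (LL emb (\<lambda>P. int (A P))) \<le> CARD('k) ^ (sum A S + 1)"
    using card_LL_le[OF S, of A] by (auto simp: A_def)
  have "(\<Sum>j\<in>I. peval (c j) x * z j) \<in> LL emb (\<lambda>P. int (A P))"
    if c: "c \<in> PiE I (\<lambda>_. polys_lt l)" for c
    unfolding LL_iff
  proof (intro allI impI vge_sum)
    fix P j assume P: "place emb P" and j: "j \<in> I"
    have cj: "c j \<in> polys_lt l" using c j by blast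
    show "vge P (- int (A P)) (peval (c j) x * z j)"
    proof (cases "P \<in> S")
      case True
      have "vge P (- int (m P)) x" using m[OF True] by (simp add: vge_def)
      from vge_mult[OF P vge_peval_pole[OF P this cj] zC[OF j]] show ?thesis
        using True by (simp add: A_def)
    next
      case False
      then have "vge P 0 x" using poles[OF P] by (simp add: vge_def)
      from vge_mult[OF P vge_peval[OF P this] d(2)[OF P this]] show ?thesis
        using False by (simp add: A_def z_def)
    qed
  qed
  then have "card ((\<lambda>c. \<Sum>j\<in>I. peval (c j) x * z j) ` PiE I (\<lambda>_. polys_lt l))
      \<le> card (LL emb (\<lambda>P. int (A P)))"
    by (intro card_mono fin) blast
  then have "CARD('k) ^ (l * card I) \<le> CARD('k) ^ (sum A S + 1)"
    using card card_combinations[OF I z, of l] by simp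
  moreover have "CARD('k) > 1" by (rule card_constants)
  ultimately have "l * card I \<le> sum A S + 1" by (rule power_le_imp_le_exp[rotated])
  also have "sum A S = l * sum m S + sum C S"
    by (simp add: A_def sum.distrib sum_distrib_left)
  finally have "l * card I \<le> l * sum m S + sum C S + 1" by simp
  moreover have "l * Suc (sum m S) \<le> l * card I" using contra by (intro mult_le_mono2) simp
  ultimately show False by (simp add: l_def)
qed

text \<open>For \<open>x \<noteq> 0\<close> in the space, all poles lie in the support of
  \<open>E\<close>, and the orders there sum to at least \<open>- rdeg E > 0\<close>. The zeros in
  the support would then outnumber the poles, whereas \<open>indep_at_zeros\<close> and
  \<open>card_indep_le_poles\<close> together forbid this.\<close>

lemma LL_eq_0_of_rdeg_neg:
  assumes E: "rat_divisor emb E" and deg: "rdeg E < 0"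
  shows "LL emb E = {0}"
proof -
  define S where "S = supp E"
  have S: "finite S" "\<And>P. P \<in> S \<Longrightarrow> rational_place emb P"
    using E by (auto simp: rat_divisor_def is_divisor_def supp_def S_def)
  have pl: "place emb P" if "P \<in> S" for P using S(2)[OF that] by (simp add: rational_place_def)
  have "x = 0" if x: "x \<in> LL emb E" for x
  proof (rule ccontr)
    assume x0: "x \<noteq> 0"
    have xE: "P x \<ge> - E P" if "place emb P" for P
      using x x0 that by (auto simp: LL_iff vge_def)
    have "(\<Sum>P\<in>S. P x) \<ge> (\<Sum>P\<in>S. - E P)" by (intro sum_mono xE pl)
    then have pos: "(\<Sum>P\<in>S. P x) > 0" using deg by (simp add: rdeg_def S_def sum_negf)
    have x_transc: "transc emb x"
    proof (rule algebraic_or_transc[of x])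
      fix c assume "x = emb c"
      then have "(\<Sum>P\<in>S. P x) = 0" using place_emb[OF pl] by (intro sum.neutral) blast
      with pos show ?thesis by simp
    qed
    define S1 where "S1 = {P \<in> S. P x \<ge> 0}"
    define S2 where "S2 = {P \<in> S. P x < 0}"
    have fin: "finite S1" "finite S2" using S(1) by (auto simp: S1_def S2_def)
    let ?I = "SIGMA P:S1. {..<nat (P x)}"
    have "\<exists>w. indep_over x ?I w"
      by (rule indep_at_zeros) (use fin S(2) x0 in \<open>auto simp: S1_def\<close>)
    then obtain w where w: "indep_over x ?I w" by blast
    have "card ?I \<le> (\<Sum>P\<in>S2. nat (- P x))"
    proof (rule card_indep_le_poles[OF x_transc _ w fin(2)])
      show "finite ?I" using fin by simp
      show "rational_place emb P" if "P \<in> S2" for P using that S(2) by (simp add: S2_def)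
      show "P x = - int (nat (- P x))" if "P \<in> S2" for P using that by (simp add: S2_def)
      show "P x \<ge> 0" if "place emb P" "P \<notin> S2" for P
        using that xE[of P] by (cases "P \<in> S") (auto simp: S2_def S_def supp_def)
    qed
    moreover have "card ?I = (\<Sum>P\<in>S1. nat (P x))" using fin by simp
    ultimately have "(\<Sum>P\<in>S1. nat (P x)) \<le> (\<Sum>P\<in>S2. nat (- P x))" by simp
    then have "int (\<Sum>P\<in>S1. nat (P x)) \<le> int (\<Sum>P\<in>S2. nat (- P x))"
      by (simp only: of_nat_le_iff)
    moreover have "int (\<Sum>P\<in>S1. nat (P x)) = (\<Sum>P\<in>S1. P x)"
      by (simp add: S1_def)
    moreover have "int (\<Sum>P\<in>S2. nat (- P x)) = (\<Sum>P\<in>S2. - P x)"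
      by (simp add: S2_def)
    moreover have "(\<Sum>P\<in>S. P x) = (\<Sum>P\<in>S1. P x) + (\<Sum>P\<in>S2. P x)"
      using fin by (subst sum.union_disjoint[symmetric]) (auto simp: S1_def S2_def intro: sum.cong)
    ultimately show False using pos by (simp add: sum_negf)
  qed
  then show ?thesis by (auto simp: LL_def)
qed

end

section \<open>Codes\<close>

text \<open>Adding a basis vector multiplies the size of the span by \<open>CARD('k)\<close>. This
  trades comparisons of dimensions for comparisons of cardinalities.\<close>

lemma card_subspace:
  fixes scale :: "'k::{finite,field} \<Rightarrow> 'b::ab_group_add \<Rightarrow> 'b"
  assumes "vector_space scale" "module.subspace scale V" "finite V"
  shows "card V = CARD('k) ^ vector_space.dim scale V"
proof -
  interpret vector_space scale by fact
  have span_card: "card (span B) = CARD('k) ^ card B" if "finite B" "independent B" for B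
    using that
  proof (induction B rule: finite_induct)
    case empty then show ?case by simp
  next
    case (insert a B)
    then have ind: "independent B" "a \<notin> span B" by (auto simp: independent_insert)
    let ?g = "\<lambda>(c, x). scale c a + x"
    have "x = ?g (k, x - scale k a)" for x k by simp
    then have "span (insert a B) \<subseteq> ?g ` (UNIV \<times> span B)"
      unfolding span_insert by blast
    moreover have "?g ` (UNIV \<times> span B) \<subseteq> span (insert a B)"
      unfolding span_insert
    proof (rule image_subsetI)
      fix p :: "'k \<times> 'b" assume "p \<in> UNIV \<times> span B"
      then show "?g p \<in> {x. \<exists>k. x - scale k a \<in> span B}"
        by (cases p) (auto intro!: exI[of _ "fst p"])
    qed
    moreover have "inj_on ?g (UNIV \<times> span B)"
    proof (rule inj_onI, clarify)
      fix c x d y assume xy: "x \<in> span B" "y \<in> span B" and eq: "scale c a + x = scale d a + y"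
      then have "scale (c - d) a = y - x" by (simp add: algebra_simps)
      then have "scale (c - d) a \<in> span B" using span_diff[OF xy(2,1)] by simp
      then have "c = d"
        using ind(2) span_scale[of "scale (c - d) a" B "inverse (c - d)"] by (cases "c = d") auto
      with eq show "c = d \<and> x = y" by simp
    qed
    ultimately have "card (span (insert a B)) = card ((UNIV :: 'k set) \<times> span B)"
      using card_image[of ?g] by (metis subset_antisym)
    then show ?case using insert ind by (simp add: card_cartesian_product)
  qed
  obtain B where B: "B \<subseteq> V" "independent B" "V \<subseteq> span B" "card B = dim V"
    using basis_exists by blast
  have "span B = V" using B(1,3) assms(2) span_minimal by blast
  then show ?thesis using span_card[of B] B assms(3) finite_subset by fastforce
qed

lemma vector_space_pointwise:
  "vector_space (\<lambda>(c::'k::field) v. (\<lambda>P. c * v P))"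
  by unfold_locales (auto simp: algebra_simps)

lemma (in constants) vector_space_emb: "vector_space (\<lambda>c y. emb c * y)"
  by unfold_locales (auto simp: algebra_simps emb_add emb_mult)

lemma supp_point_divisor: "supp (point_divisor Ps) = Ps"
  by (auto simp: supp_def point_divisor_def)

text \<open>For infinite \<open>Ps\<close> both sides are \<open>0\<close> by the conventions for
  \<open>sum\<close> and \<open>card\<close>.\<close>

lemma rdeg_point_divisor: "rdeg (point_divisor Ps) = int (card Ps)"
  by (simp add: rdeg_def supp_point_divisor) (simp add: point_divisor_def)

section \<open>Evaluation codes\<close>

context curve
begin

lemma card_LL_ell:
  assumes "finite (LL emb E)"
  shows "card (LL emb E) = CARD('k) ^ ell emb E"
  unfolding ell_def
proof (rule card_subspace[OF vector_space_emb _ assms])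
  interpret vector_space "\<lambda>c y. emb c * y" by (rule vector_space_emb)
  show "subspace (LL emb E)"
    by (intro subspaceI LL_add LL_emb_mult) (auto simp: LL_iff)
qed

context
  fixes Ps assumes Ps: "\<And>P. P \<in> Ps \<Longrightarrow> rational_place emb P"
begin

definition "regular_at y \<longleftrightarrow> (\<forall>P\<in>Ps. vge P 0 y)"

lemma ev_add: "regular_at y \<Longrightarrow> regular_at z \<Longrightarrow> ev emb Ps (y + z) = ev emb Ps y + ev emb Ps z"
  using Ps by (auto simp: ev_def regular_at_def eval_at_add fun_eq_iff)

lemma ev_mult:
  "regular_at y \<Longrightarrow> regular_at z \<Longrightarrow> ev emb Ps (y * z) = (\<lambda>P. ev emb Ps y P * ev emb Ps z P)"
  using Ps by (auto simp: ev_def regular_at_def eval_at_mult fun_eq_iff)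

lemma ev_emb_mult:
  assumes "regular_at y"
  shows "ev emb Ps (emb c * y) = (\<lambda>P. c * ev emb Ps y P)"
proof
  fix P show "ev emb Ps (emb c * y) P = c * ev emb Ps y P"
  proof (cases "P \<in> Ps")
    case True
    then have "rational_place emb P" "vge P 0 y" "place emb P"
      using Ps assms by (auto simp: regular_at_def rational_place_def)
    then show ?thesis
      using True by (simp add: ev_def eval_at_mult eval_at_emb vge_emb)
  qed (simp add: ev_def)
qed

lemma ev_diff:
  assumes "regular_at y" "regular_at z"
  shows "ev emb Ps (y - z) = ev emb Ps y - ev emb Ps z"
proof -
  have "regular_at (y - z)"
    using assms Ps vge_diff by (auto simp: regular_at_def rational_place_def)
  then have "ev emb Ps (y - z + z) = ev emb Ps (y - z) + ev emb Ps z"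
    using assms by (intro ev_add)
  then show ?thesis by (simp add: algebra_simps)
qed

lemma ev_eq_imp:
  assumes "regular_at y" "regular_at z" "ev emb Ps y = ev emb Ps z" "P \<in> Ps"
  shows "vge P 1 (y - z)"
proof -
  have "regular_at (y - z)"
    using assms Ps vge_diff by (auto simp: regular_at_def rational_place_def)
  moreover have "ev emb Ps (y - z) P = 0" using ev_diff[OF assms(1,2)] assms(3) by simp
  ultimately show ?thesis
    using assms(4) eval_at_eq_0_iff[OF Ps[OF assms(4)]] by (simp add: ev_def regular_at_def)
qed

lemma regular_at_LL:
  assumes "y \<in> LL emb E" "\<And>P. P \<in> Ps \<Longrightarrow> E P \<le> 0"
  shows "regular_at y"
  using assms Ps unfolding regular_at_def LL_iff rational_place_def
  by (metis neg_0_le_iff_le vge_mono)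

text \<open>Functions with equal evaluations differ by an element of \<open>L(G - D)\<close>, which
  is zero because \<open>G - D\<close> has negative degree.\<close>

lemma ev_inj_on_LL:
  assumes fin: "finite Ps" and G: "rat_divisor emb G" "\<And>P. P \<in> Ps \<Longrightarrow> G P = 0"
    and deg: "rdeg G < int (card Ps)"
  shows "inj_on (ev emb Ps) (LL emb G)"
proof (rule inj_onI)
  fix y z assume yz: "y \<in> LL emb G" "z \<in> LL emb G" "ev emb Ps y = ev emb Ps z"
  let ?E = "\<lambda>P. G P - point_divisor Ps P"
  have finG: "finite (supp G)" using G(1) by (simp add: rat_divisor_def is_divisor_def supp_def)
  have E: "rat_divisor emb ?E"
  proof -
    have "{P. ?E P \<noteq> 0} \<subseteq> supp G \<union> Ps" by (auto simp: supp_def point_divisor_def)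
    moreover have "rational_place emb P" if "P \<in> supp G \<union> Ps" for P
      using that G(1) Ps by (auto simp: supp_def rat_divisor_def)
    moreover have "finite (supp G \<union> Ps)" using finG fin by simp
    ultimately show ?thesis
      unfolding rat_divisor_def is_divisor_def rational_place_def
      by (metis (mono_tags, lifting) finite_subset mem_Collect_eq subsetD)
  qed
  have "supp ?E = supp G \<union> Ps" "supp G \<inter> Ps = {}"
    using G(2) by (auto simp: supp_def point_divisor_def)
  then have "rdeg ?E = (\<Sum>P\<in>supp G. ?E P) + (\<Sum>P\<in>Ps. ?E P)"
    unfolding rdeg_def using finG fin by (simp add: sum.union_disjoint)
  also have "(\<Sum>P\<in>supp G. ?E P) = rdeg G"
    unfolding rdeg_def using \<open>supp G \<inter> Ps = {}\<close>
    by (intro sum.cong) (auto simp: point_divisor_def)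
  also have "(\<Sum>P\<in>Ps. ?E P) = - int (card Ps)"
    using G(2) by (simp add: point_divisor_def)
  finally have "rdeg ?E < 0" using deg by simp
  then have "LL emb ?E = {0}" by (rule LL_eq_0_of_rdeg_neg[OF E])
  moreover have "y - z \<in> LL emb ?E"
    unfolding LL_iff
  proof (intro allI impI)
    fix P assume P: "place emb P"
    have reg: "regular_at y" "regular_at z" using yz G(2) by (auto intro: regular_at_LL)
    show "vge P (- ?E P) (y - z)"
      using ev_eq_imp[OF reg yz(3), of P] LL_diff[OF yz(1,2)] P G(2)
      by (cases "P \<in> Ps") (auto simp: point_divisor_def LL_iff)
  qed
  ultimately show "y = z" by simp
qed

text \<open>\<open>B\<close> stands for \<open>H - (f)\<close>. A common codeword is sent to the
  difference of its chosen preimages in \<open>L(A)\<close> and \<open>L(B)\<close>; the image lies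
  in \<open>L(lcm - D)\<close>, and codewords in one fibre differ by evaluations of elements of
  \<open>L(A) \<inter> L(B)\<close>.\<close>

lemma card_inter_codes:
  assumes A: "finite (LL emb A)" and Y: "finite (LL emb (\<lambda>P. dlcm A B P - point_divisor Ps P))"
    and inj: "inj_on (ev emb Ps) (LL emb A)"
    and neg: "\<And>P. P \<in> Ps \<Longrightarrow> A P \<le> 0" "\<And>P. P \<in> Ps \<Longrightarrow> B P \<le> 0"
    and zero: "\<And>P. P \<in> Ps \<Longrightarrow> dlcm A B P = 0"
  shows "ell emb (dgcd A B) \<le> code_dim (ev emb Ps ` LL emb A \<inter> ev emb Ps ` LL emb B)"
    and "code_dim (ev emb Ps ` LL emb A \<inter> ev emb Ps ` LL emb B)
      \<le> ell emb (dgcd A B) + ell emb (\<lambda>P. dlcm A B P - point_divisor Ps P)"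
proof -
  let ?e = "ev emb Ps" and ?Y = "LL emb (\<lambda>P. dlcm A B P - point_divisor Ps P)"
  define W where "W = ?e ` LL emb A \<inter> ?e ` LL emb B"
  have gcd: "LL emb (dgcd A B) = LL emb A \<inter> LL emb B"
  proof -
    have "vge P (- min m n) y \<longleftrightarrow> vge P (- m) y \<and> vge P (- n) y" for P :: "'f \<Rightarrow> int" and m n y
      unfolding vge_def by linarith
    then show ?thesis unfolding dgcd_def set_eq_iff Int_iff LL_iff by blast
  qed
  have fin_gcd: "finite (LL emb (dgcd A B))" using A by (simp add: gcd)
  have finW: "finite W" using A by (simp add: W_def)
  have regA: "regular_at y" if "y \<in> LL emb A" for y using that neg(1) by (rule regular_at_LL)
  have regB: "regular_at y" if "y \<in> LL emb B" for y using that neg(2) by (rule regular_at_LL)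
  have cardW: "card W = CARD('k) ^ code_dim W"
    unfolding code_dim_def
  proof (rule card_subspace[OF vector_space_pointwise _ finW])
    interpret vector_space "\<lambda>(c::'k) v. (\<lambda>P :: 'f \<Rightarrow> int. c * v P)" by (rule vector_space_pointwise)
    have sub: "subspace (?e ` LL emb E)" if reg: "\<And>y. y \<in> LL emb E \<Longrightarrow> regular_at y" for E
    proof (intro subspaceI)
      have "?e 0 = 0" using ev_diff[of 0 0] reg by (simp add: regular_at_def)
      then show "0 \<in> ?e ` LL emb E" by (metis LL_iff imageI vge_0)
      show "v + w \<in> ?e ` LL emb E" if "v \<in> ?e ` LL emb E" "w \<in> ?e ` LL emb E" for v w
        using that LL_add reg by (auto simp flip: ev_add)
      show "(\<lambda>P. c * v P) \<in> ?e ` LL emb E" if "v \<in> ?e ` LL emb E" for c v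
        using that LL_emb_mult reg by (auto simp flip: ev_emb_mult)
    qed
    show "subspace W" unfolding W_def using sub[OF regA] sub[OF regB] by (rule subspace_inter)
  qed
  have q: "CARD('k) > 1" by (rule card_constants)
  let ?Z = "?e ` (LL emb A \<inter> LL emb B)"
  have finZ: "finite ?Z" using A by simp
  have cardZ: "card ?Z = CARD('k) ^ ell emb (dgcd A B)"
    using card_image[OF inj_on_subset[OF inj]] card_LL_ell[OF fin_gcd] by (simp add: gcd)
  have "card ?Z \<le> card W" by (intro card_mono finW) (auto simp: W_def)
  then show "ell emb (dgcd A B) \<le> code_dim (?e ` LL emb A \<inter> ?e ` LL emb B)"
    using q unfolding cardZ cardW W_def[symmetric] by (rule power_le_imp_le_exp[rotated])
  \<comment> \<open>Arbitrary preimages suffice, since \<open>card_le_fibres\<close> asks for no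
    linearity.\<close>
  define a b where "a = inv_into (LL emb A) ?e" and "b = inv_into (LL emb B) ?e"
  have ab: "a w \<in> LL emb A" "b w \<in> LL emb B" "?e (a w) = w" "?e (b w) = w" if "w \<in> W" for w
    using that unfolding W_def a_def b_def by (simp_all add: inv_into_into f_inv_into_f)
  have "card W \<le> card ?Y * card ?Z"
  proof (rule card_le_fibres(2)[where h = "\<lambda>w. a w - b w"])
    show "finite ?Y" "finite ?Z" by fact+
    show "(\<lambda>w. a w - b w) ` W \<subseteq> ?Y"
    proof clarify
      fix w assume w: "w \<in> W"
      show "a w - b w \<in> ?Y"
        unfolding LL_iff
      proof (intro allI impI)
        fix P assume P: "place emb P"
        show "vge P (- (dlcm A B P - point_divisor Ps P)) (a w - b w)"
        proof (cases "P \<in> Ps")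
          case True
          \<comment> \<open>Both preimages take the value \<open>w P\<close>, so their difference
            vanishes at \<open>P\<close>. This is the order \<open>1\<close> that
            \<open>lcm - D\<close> demands, as the lcm is \<open>0\<close> there.\<close>
          from ev_eq_imp[OF regA[OF ab(1)[OF w]] regB[OF ab(2)[OF w]] _ True] ab(3,4)[OF w]
          show ?thesis using zero[OF True] True by (simp add: point_divisor_def)
        next
          case False
          have "vge P (- A P) (a w)" "vge P (- B P) (b w)"
            using ab(1,2)[OF w] P by (auto simp: LL_iff)
          then have "vge P (- dlcm A B P) (a w)" "vge P (- dlcm A B P) (b w)"
            by (auto simp: dlcm_def elim: vge_mono)
          then show ?thesis using False vge_diff[OF P] by (simp add: point_divisor_def)
        qed
      qed
    qed
    show "w - w' \<in> ?Z" if w: "w \<in> W" "w' \<in> W" and eq: "a w - b w = a w' - b w'" for w w'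
    proof
      have "a w - a w' = b w - b w'" using eq by (simp add: algebra_simps)
      then show "a w - a w' \<in> LL emb A \<inter> LL emb B"
        using LL_diff[OF ab(1)[OF w(1)] ab(1)[OF w(2)]] LL_diff[OF ab(2)[OF w(1)] ab(2)[OF w(2)]]
        by simp
      show "w - w' = ?e (a w - a w')" using ev_diff[OF regA regA] ab w by simp
    qed
  qed
  also have "\<dots> = CARD('k) ^ (ell emb (dgcd A B) + ell emb (\<lambda>P. dlcm A B P - point_divisor Ps P))"
    by (simp add: cardZ card_LL_ell[OF Y] power_add)
  finally show "code_dim (?e ` LL emb A \<inter> ?e ` LL emb B)
      \<le> ell emb (dgcd A B) + ell emb (\<lambda>P. dlcm A B P - point_divisor Ps P)"
    using q unfolding cardW W_def[symmetric] by (rule power_le_imp_le_exp[rotated])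
qed

text \<open>Multiplication by \<open>f\<close> maps \<open>L(H)\<close> onto
  \<open>L(H - (f))\<close>, and evaluation is multiplicative on functions regular at the
  points.\<close>

lemma star_prod_AG_code:
  assumes f: "f \<noteq> 0" "regular_at f" and H: "\<And>P. P \<in> Ps \<Longrightarrow> H P \<le> 0"
  shows "star_prod (ev emb Ps f) (AG_code emb Ps H)
    = ev emb Ps ` LL emb (\<lambda>P. H P - pdiv emb f P)"
proof -
  have mult_iff: "vge P (- (H P - pdiv emb f P)) (f * h) \<longleftrightarrow> vge P (- H P) h" if "place emb P" for P h
    using that f(1) by (cases "h = 0") (auto simp: vge_def pdiv_def place_mult)
  have "LL emb (\<lambda>P. H P - pdiv emb f P) = (*) f ` LL emb H"
  proof
    show "(*) f ` LL emb H \<subseteq> LL emb (\<lambda>P. H P - pdiv emb f P)"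
      using mult_iff by (auto simp: LL_iff)
    show "LL emb (\<lambda>P. H P - pdiv emb f P) \<subseteq> (*) f ` LL emb H"
    proof
      fix y assume y: "y \<in> LL emb (\<lambda>P. H P - pdiv emb f P)"
      have "y = f * (y / f)" using f(1) by simp
      moreover have "y / f \<in> LL emb H"
        using y mult_iff[of _ "y / f"] f(1) by (simp add: LL_iff)
      ultimately show "y \<in> (*) f ` LL emb H" by blast
    qed
  qed
  moreover have "(\<lambda>P. ev emb Ps f P * ev emb Ps h P) = ev emb Ps (f * h)" if "h \<in> LL emb H" for h
    by (rule ev_mult[OF f(2) regular_at_LL[OF that H], symmetric])
  ultimately show ?thesis
    unfolding star_prod_def AG_code_def by (simp add: image_image cong: image_cong_simp)
qed

end

end

theorem theorem4p1:
  fixes emb :: "'k::{finite,field} \<Rightarrow> 'f::field"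
    and Ps :: "('f \<Rightarrow> int) set"
    and G H J :: "'f divisor"
  assumes "function_field emb"
    and "Ps \<subset> {P. rational_place emb P}"
    and "rat_divisor emb G" and "rat_divisor emb H" and "rat_divisor emb J"
    and "rdeg G \<le> rdeg (point_divisor Ps) - 1"
    and "rdeg H \<le> rdeg (point_divisor Ps) - 1"
    and "rdeg J \<le> rdeg (point_divisor Ps) - 1"
    and "(supp G \<union> supp H \<union> supp J) \<inter> supp (point_divisor Ps) = {}"
  shows "\<forall>f \<in> LL emb J - {0}.
     (let Hf = (\<lambda>P. H P - pdiv emb f P) in
        ell emb (dgcd G Hf)
          \<le> code_dim (AG_code emb Ps G \<inter> star_prod (ev emb Ps f) (AG_code emb Ps H))
      \<and> code_dim (AG_code emb Ps G \<inter> star_prod (ev emb Ps f) (AG_code emb Ps H))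
          \<le> ell emb (dgcd G Hf) + ell emb (\<lambda>P. dlcm G Hf P - point_divisor Ps P))"
proof
  interpret curve emb
    using assms(1) by unfold_locales (auto simp: function_field_def)
  fix f assume f: "f \<in> LL emb J - {0}"
  define Hf where "Hf = (\<lambda>P. H P - pdiv emb f P)"
  have Ps: "\<And>P. P \<in> Ps \<Longrightarrow> rational_place emb P" using assms(2) by blast
  have finite_Ps: "finite Ps"
  proof (rule ccontr)
    assume "infinite Ps"
    then have "rdeg J < 0" using assms(8) by (simp add: rdeg_point_divisor)
    with LL_eq_0_of_rdeg_neg[OF assms(5)] f show False by simp
  qed
  have zero: "G P = 0" "H P = 0" "J P = 0" if "P \<in> Ps" for P
    using assms(9) that by (auto simp: supp_point_divisor) (auto simp: supp_def)
  have reg: "regular_at Ps f" using f zero(3) by (intro regular_at_LL[where E = J, OF Ps]) auto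
  have pdiv: "pdiv emb f P \<ge> - J P" if "place emb P" for P
    using f that by (auto simp: LL_iff vge_def pdiv_def)
  \<comment> \<open>As \<open>J\<close> vanishes on \<open>Ps\<close>, \<open>f\<close> has no poles
    there; it may have zeros, so only an inequality holds.\<close>
  have neg: "Hf P \<le> 0" if "P \<in> Ps" for P
    using pdiv[of P] Ps[OF that] zero[OF that] by (simp add: Hf_def rational_place_def)
  \<comment> \<open>The divisor of \<open>f\<close> may involve places that are not rational, so
    \<open>finite_LL\<close> does not apply to the lcm directly; \<open>(f) \<ge> - J\<close> puts
    it below this rational divisor.\<close>
  let ?M = "\<lambda>P. max (G P) (H P + J P)"
  have "rat_divisor emb ?M"
  proof -
    have *: "{P. ?M P \<noteq> 0} \<subseteq> {P. G P \<noteq> 0} \<union> {P. H P \<noteq> 0} \<union> {P. J P \<noteq> 0}" by auto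
    have "finite {P. ?M P \<noteq> 0}"
      using finite_subset[OF *] assms(3-5) by (simp add: rat_divisor_def is_divisor_def)
    moreover have "rational_place emb P" if "?M P \<noteq> 0" for P
      using * that assms(3-5) unfolding rat_divisor_def by blast
    ultimately show ?thesis by (simp add: rat_divisor_def is_divisor_def rational_place_def)
  qed
  then have "finite (LL emb ?M)" by (rule finite_LL)
  moreover have "LL emb (\<lambda>P. dlcm G Hf P - point_divisor Ps P) \<subseteq> LL emb ?M"
  proof (rule LL_mono)
    fix P assume "place emb P"
    from pdiv[OF this] show "dlcm G Hf P - point_divisor Ps P \<le> ?M P"
      by (auto simp: dlcm_def Hf_def point_divisor_def)
  qed
  ultimately have fin_lcm: "finite (LL emb (\<lambda>P. dlcm G Hf P - point_divisor Ps P))"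
    by (rule finite_subset[rotated])
  have star: "star_prod (ev emb Ps f) (AG_code emb Ps H) = ev emb Ps ` LL emb Hf"
    unfolding Hf_def by (rule star_prod_AG_code[OF Ps]) (use f reg zero in auto)
  have inj: "inj_on (ev emb Ps) (LL emb G)"
    using assms(6) by (intro ev_inj_on_LL[OF Ps finite_Ps assms(3)] zero)
      (auto simp: rdeg_point_divisor)
  have lcm0: "dlcm G Hf P = 0" if "P \<in> Ps" for P
    using zero(1) neg that by (simp add: dlcm_def)
  have G_le: "G P \<le> 0" if "P \<in> Ps" for P using zero(1)[OF that] by simp
  note bounds = card_inter_codes[OF Ps finite_LL[OF assms(3)] fin_lcm inj G_le neg lcm0]
  show "let Hf = (\<lambda>P. H P - pdiv emb f P) in
        ell emb (dgcd G Hf)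
          \<le> code_dim (AG_code emb Ps G \<inter> star_prod (ev emb Ps f) (AG_code emb Ps H))
      \<and> code_dim (AG_code emb Ps G \<inter> star_prod (ev emb Ps f) (AG_code emb Ps H))
          \<le> ell emb (dgcd G Hf) + ell emb (\<lambda>P. dlcm G Hf P - point_divisor Ps P)"
    unfolding Let_def Hf_def[symmetric] star unfolding AG_code_def
    using bounds by blast
qed

end
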